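(* Let $X$ be an infinite-dimensional reflexive real Banach space with topological dual $X^*$, and let $T:X\to X^*$ be a continuous potential operator. For $x\in X$ put $J_T(x)=\int_0^1 T(sx)(x)\,ds$. Assume that $T$ is closed and non-monotone, that $J_T$ is sequentially weakly lower semicontinuous, and that $J_T+\varphi$ is coercive for every $\varphi\in X^*$. Suppose moreover that there exists a closed, $\sigma$-compact set $B\subset X$ such that the restriction of $T$ to $X\setminus B$ is of class $C^1$. Let $\tilde S_{T_{|(X\setminus B)}}$ be the set of all $x_0\in X\setminus B$ such that the operator $T'(x_0)\in\mathcal{L}(X,X^* )$ is not invertible. Then neither $\tilde S_{T_{|(X\setminus B)}}$ nor $T(\tilde S_{T_{|(X\setminus B)}})$ is $\sigma$-compact.
   Context: $X$ and $X^*$ carry their norm topologies; $\mathcal{L}(X,X^* )$ is the space of continuous linear operators from $X$ to $X^*$. A continuous operator $T:X\to X^*$ is a potential operator if the functional $J_T(x)=\int_0^1 T(sx)(x)\,ds$ is of class $C^1$ on $X$ and its Gâteaux derivative is equal to $T$. $T$ is monotone if $(T(x)-T(y))(x-y)\ge 0$ for all $x,y\in X$; non-monotone means not monotone. $T$ is closed if for each closed set $C\subseteq X$ the set $T(C)$ is closed in $X^*$. A functional $I:X\to\mathbb{R}$ is coercive if $\lim_{\|x\|\to+\infty}I(x)=+\infty$. A set in a topological space is $\sigma$-compact if it is the union of an at most countable family of compact sets. *)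

theory Defs
  imports "HOL-Analysis.Analysis"
begin

definition infinite_dimensional :: "'a::real_vector itself \<Rightarrow> bool"
  where "infinite_dimensional _ \<longleftrightarrow> \<not> (\<exists>E :: 'a set. finite E \<and> span E = UNIV)"

(* blinfun.prod_left x is evaluation at x, i.e. the canonical embedding of the space
   into its bidual. *)
definition reflexive_space :: "'a::real_normed_vector itself \<Rightarrow> bool"
  where "reflexive_space _ \<longleftrightarrow>
    surj (blinfun.prod_left :: 'a \<Rightarrow> (('a \<Rightarrow>\<^sub>L real) \<Rightarrow>\<^sub>L real))"

definition weakly_converges :: "(nat \<Rightarrow> 'a::real_normed_vector) \<Rightarrow> 'a \<Rightarrow> bool"
  where "weakly_converges u x \<longleftrightarrow>
    (\<forall>\<phi> :: 'a \<Rightarrow>\<^sub>L real. (\<lambda>n. blinfun_apply \<phi> (u n)) \<longlonglongrightarrow> blinfun_apply \<phi> x)"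

(* The liminf may be infinite, hence the passage to the extended reals. *)
definition seq_weakly_lsc :: "('a::real_normed_vector \<Rightarrow> real) \<Rightarrow> bool"
  where "seq_weakly_lsc f \<longleftrightarrow>
    (\<forall>u x. weakly_converges u x \<longrightarrow> ereal (f x) \<le> liminf (\<lambda>n. ereal (f (u n))))"

(* For functions on normed spaces, at_infinity is the filter of norms tending to infinity. *)
definition coercive :: "('a::real_normed_vector \<Rightarrow> real) \<Rightarrow> bool"
  where "coercive f \<longleftrightarrow> filterlim f at_top at_infinity"

definition has_gateaux_derivative ::
    "('a::real_normed_vector \<Rightarrow> 'b::real_normed_vector) \<Rightarrow> ('a \<Rightarrow>\<^sub>L 'b) \<Rightarrow> 'a \<Rightarrow> bool"
  where "has_gateaux_derivative f A x \<longleftrightarrow>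
    (\<forall>h. ((\<lambda>t::real. (f (x + t *\<^sub>R h) - f x) /\<^sub>R t) \<longlongrightarrow> blinfun_apply A h) (at 0))"

(* The Frechet derivative as an element of the normed space of bounded operators;
   meaningful only at points of differentiability. *)
definition fderiv ::
    "('a::real_normed_vector \<Rightarrow> 'b::real_normed_vector) \<Rightarrow> 'a \<Rightarrow> ('a \<Rightarrow>\<^sub>L 'b)"
  where "fderiv f x = Blinfun (frechet_derivative f (at x))"

definition C1_on ::
    "('a::real_normed_vector \<Rightarrow> 'b::real_normed_vector) \<Rightarrow> 'a set \<Rightarrow> bool"
  where "C1_on f S \<longleftrightarrow>
    open S \<and> (\<forall>x\<in>S. f differentiable (at x)) \<and> continuous_on S (fderiv f)"

definition potential :: "('a::real_normed_vector \<Rightarrow> 'a \<Rightarrow>\<^sub>L real) \<Rightarrow> 'a \<Rightarrow> real"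
  where "potential T x = integral {0..1} (\<lambda>s. blinfun_apply (T (s *\<^sub>R x)) x)"

definition potential_operator :: "('a::real_normed_vector \<Rightarrow> 'a \<Rightarrow>\<^sub>L real) \<Rightarrow> bool"
  where "potential_operator T \<longleftrightarrow>
    continuous_on UNIV T \<and> C1_on (potential T) UNIV \<and>
    (\<forall>x. has_gateaux_derivative (potential T) (T x) x)"

definition monotone_operator :: "('a::real_normed_vector \<Rightarrow> 'a \<Rightarrow>\<^sub>L real) \<Rightarrow> bool"
  where "monotone_operator T \<longleftrightarrow> (\<forall>x y. blinfun_apply (T x - T y) (x - y) \<ge> 0)"

definition sigma_compact :: "'a::topological_space set \<Rightarrow> bool"
  where "sigma_compact S \<longleftrightarrow> (\<exists>\<K>. countable \<K> \<and> (\<forall>K\<in>\<K>. compact K) \<and> S = \<Union>\<K>)"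

definition invertible_operator ::
    "('a::real_normed_vector \<Rightarrow>\<^sub>L 'b::real_normed_vector) \<Rightarrow> bool"
  where "invertible_operator A \<longleftrightarrow>
    (\<exists>C :: 'b \<Rightarrow>\<^sub>L 'a. C o\<^sub>L A = id_blinfun \<and> A o\<^sub>L C = id_blinfun)"

definition singular_points ::
    "('a::real_normed_vector \<Rightarrow> 'b::real_normed_vector) \<Rightarrow> 'a set \<Rightarrow> 'a set"
  where "singular_points f S = {x \<in> S. \<not> invertible_operator (fderiv f x)}"

end

theory Submission
  imports Defs "HOL-Library.Diagonal_Subsequence"
begin

text \<open>
Suppose the singular values form a \<open>\<sigma>\<close>-compact set. Then so do the values \<open>D\<close> that \<open>T\<close> takes at the
points where it is not a local homeomorphism, because these points lie in \<open>B\<close> or are singular. In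
infinite dimensions the compact boundary of a fibre of \<open>T\<close> does not separate \<open>X\<close>, so all fibres
are compact, \<open>T\<close> is proper, and \<open>E = T\<^sup>-\<^sup>1(D)\<close> is \<open>\<sigma>\<close>-compact as well. Hence \<open>T\<close> is a covering of
\<open>X\<^sup>* \ D\<close> by \<open>X \ E\<close>. Paths and cones can be moved off \<open>\<sigma>\<close>-compact sets, so the total space is
connected, loops in the base are contractible, and \<open>T\<close> is injective on \<open>X \ E\<close>. By reflexivity every
\<open>J\<^sub>T - \<phi>\<close> attains its minimum, at a solution of \<open>T(x) = \<phi>\<close>; so each \<open>x\<close> outside \<open>E\<close> minimises
\<open>J\<^sub>T - T(x)\<close>. By density this holds for all \<open>x\<close>, which makes \<open>T\<close> monotone.
\<close>

subsection \<open>The Hahn--Banach theorem\<close>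

text \<open>Scaling is asked for as an inequality at positive factors, which is what constructions
  by infima deliver; \<open>sublinear_scaleR\<close> recovers equality by applying it to
  \<open>1/t\<close> as well.\<close>

definition sublinear :: "('a::real_vector \<Rightarrow> real) \<Rightarrow> bool"
  where "sublinear p \<longleftrightarrow>
    (\<forall>x y. p (x + y) \<le> p x + p y) \<and> (\<forall>t>0. \<forall>x. p (t *\<^sub>R x) \<le> t * p x) \<and> p 0 = 0"

lemma sublinearI:
  assumes "\<And>x y. p (x + y) \<le> p x + p y" "\<And>t x. t > 0 \<Longrightarrow> p (t *\<^sub>R x) \<le> t * p x" "p 0 = 0"
  shows "sublinear p"
  using assms by (simp add: sublinear_def)

lemma sublinear_add: "sublinear p \<Longrightarrow> p (x + y) \<le> p x + p y"
  by (simp add: sublinear_def)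

lemma sublinear_0: "sublinear p \<Longrightarrow> p 0 = 0"
  by (simp add: sublinear_def)

lemma sublinear_scaleR:
  assumes "sublinear p" "t \<ge> 0"
  shows "p (t *\<^sub>R x) = t * p x"
proof (cases "t = 0")
  case True
  then show ?thesis using assms by (simp add: sublinear_def)
next
  case False
  then have t: "t > 0" using assms by simp
  have "p ((1/t) *\<^sub>R (t *\<^sub>R x)) \<le> (1/t) * p (t *\<^sub>R x)"
    using assms t unfolding sublinear_def by (meson zero_less_divide_1_iff)
  then have "t * p x \<le> p (t *\<^sub>R x)"
    using t by (simp add: field_simps)
  moreover have "p (t *\<^sub>R x) \<le> t * p x"
    using assms t by (simp add: sublinear_def)
  ultimately show ?thesis by simp
qed

lemma sublinear_minus: "sublinear p \<Longrightarrow> - p (- x) \<le> p x"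
  using sublinear_add[of p x "- x"] sublinear_0[of p] by simp

text \<open>A minimal sublinear functional has to coincide with its own \<open>q\<close>, hence is
  odd in the direction \<open>h\<close>; this drives the Zorn argument below. The witness is the
  infimum over \<open>t \<ge> 0\<close> of \<open>p (x + t *\<^sub>R h) - t * p h\<close>: taking
  \<open>t = 0\<close> gives \<open>q \<le> p\<close>, and \<open>t = 1\<close> at
  \<open>- h\<close> gives the last claim.\<close>

lemma sublinear_directional:
  fixes p :: "'a::real_vector \<Rightarrow> real"
  assumes p: "sublinear p"
  obtains q where "sublinear q" "\<And>x. q x \<le> p x" "q (- h) \<le> - p h"
proof -
  define g where "g x t = p (x + t *\<^sub>R h) - t * p h" for x t
  define q where "q x = (INF t\<in>{0..}. g x t)" for x
  have bd: "bdd_below (g x ` {0..})" for x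
  proof (rule bdd_belowI2)
    fix t :: real assume t: "t \<in> {0..}"
    have "t * p h = p (- x + (x + t *\<^sub>R h))"
      using t by (simp add: sublinear_scaleR[OF p])
    also have "\<dots> \<le> p (- x) + p (x + t *\<^sub>R h)"
      by (rule sublinear_add[OF p])
    finally show "- p (- x) \<le> g x t" by (simp add: g_def)
  qed
  have low: "q x \<le> g x t" if "t \<ge> 0" for x t
    unfolding q_def using that by (intro cINF_lower bd) auto
  have great: "c \<le> q x" if "\<And>t. t \<ge> 0 \<Longrightarrow> c \<le> g x t" for c x
    unfolding q_def using that by (intro cINF_greatest) auto
  show ?thesis
  proof
    show "q x \<le> p x" for x
      using low[of 0 x] by (simp add: g_def)
    show "q (- h) \<le> - p h"
      using low[of 1 "- h"] by (simp add: g_def sublinear_0[OF p])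
    show "sublinear q"
    proof (rule sublinearI)
      fix x y
      have *: "q (x + y) \<le> g x t + g y s" if "t \<ge> 0" "s \<ge> 0" for t s
      proof -
        have "q (x + y) \<le> g (x + y) (t + s)" using that by (intro low) auto
        also have "\<dots> \<le> g x t + g y s"
          using sublinear_add[OF p, of "x + t *\<^sub>R h" "y + s *\<^sub>R h"]
          by (simp add: g_def algebra_simps)
        finally show ?thesis .
      qed
      \<comment> \<open>The two infima are taken one after the other, first over \<open>s\<close>,
        then over \<open>t\<close>.\<close>
      have "q (x + y) - g x t \<le> q y" if "t \<ge> 0" for t
        using *[OF that] by (intro great) (simp add: algebra_simps)
      then have "q (x + y) - q y \<le> q x"
        by (intro great) (simp add: algebra_simps)
      then show "q (x + y) \<le> q x + q y" by simp
    next
      fix c :: real and x :: 'a assume c: "c > 0"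
      have "q (c *\<^sub>R x) / c \<le> g x t" if "t \<ge> 0" for t
      proof -
        have "g (c *\<^sub>R x) (c * t) = c * g x t"
          using sublinear_scaleR[OF p, of c "x + t *\<^sub>R h"] c
          by (simp add: g_def algebra_simps)
        moreover have "q (c *\<^sub>R x) \<le> g (c *\<^sub>R x) (c * t)"
          using c that by (intro low) auto
        ultimately show ?thesis using c by (simp add: field_simps)
      qed
      then have "q (c *\<^sub>R x) / c \<le> q x" by (rule great)
      then show "q (c *\<^sub>R x) \<le> c * q x" using c by (simp add: field_simps)
    next
      have "g 0 t = 0" if "t \<ge> 0" for t
        using that by (simp add: g_def sublinear_scaleR[OF p])
      then show "q 0 = 0"
        using low[of 0 0] great[of 0 0] by fastforce
    qed
  qed
qed

text \<open>Supplies the bounds of chains for Zorn's lemma. The common majorant \<open>p\<close>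
  keeps the infimum finite, since \<open>- p (- x) \<le> - q (- x) \<le> q x\<close>; for
  subadditivity the smaller of two members of the chain serves both summands.\<close>

lemma sublinear_INF_chain:
  assumes C: "C \<noteq> {}" "\<And>q. q \<in> C \<Longrightarrow> sublinear q \<and> q \<le> p"
    and chain: "\<And>q r. q \<in> C \<Longrightarrow> r \<in> C \<Longrightarrow> q \<le> r \<or> r \<le> q"
  shows "sublinear (\<lambda>x. INF q\<in>C. q x)" "\<And>q. q \<in> C \<Longrightarrow> (\<lambda>x. INF q\<in>C. q x) \<le> q"
proof -
  define u where "u x = (INF q\<in>C. q x)" for x
  have bd: "bdd_below ((\<lambda>q. q x) ` C)" for x
  proof (rule bdd_belowI2)
    fix q assume "q \<in> C"
    then have "- q (- x) \<le> q x" "q (- x) \<le> p (- x)"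
      using C(2) sublinear_minus by (auto simp: le_fun_def)
    then show "- p (- x) \<le> q x" by simp
  qed
  have low: "u x \<le> q x" if "q \<in> C" for x q
    unfolding u_def using that by (intro cINF_lower bd) auto
  have great: "c \<le> u x" if "\<And>q. q \<in> C \<Longrightarrow> c \<le> q x" for c x
    unfolding u_def using that by (intro cINF_greatest C) auto
  have "sublinear u"
  proof (rule sublinearI)
    fix x y
    have *: "u (x + y) \<le> q x + r y" if qr: "q \<in> C" "r \<in> C" for q r
    proof -
      obtain s where s: "s \<in> C" "s \<le> q" "s \<le> r" using chain[OF qr] qr by auto
      have "u (x + y) \<le> s (x + y)" by (rule low[OF s(1)])
      also have "\<dots> \<le> s x + s y" using C(2)[OF s(1)] sublinear_add by blast
      also have "\<dots> \<le> q x + r y" using s by (auto simp: le_fun_def intro: add_mono)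
      finally show ?thesis .
    qed
    have "u (x + y) - q x \<le> u y" if "q \<in> C" for q
      using *[OF that] by (intro great) (simp add: algebra_simps)
    then have "u (x + y) - u y \<le> u x"
      by (intro great) (simp add: algebra_simps)
    then show "u (x + y) \<le> u x + u y" by simp
  next
    fix t :: real and x assume t: "t > 0"
    have "u (t *\<^sub>R x) / t \<le> q x" if "q \<in> C" for q
      using low[OF that, of "t *\<^sub>R x"] sublinear_scaleR[of q t x] C(2)[OF that] t
      by (simp add: field_simps)
    then have "u (t *\<^sub>R x) / t \<le> u x" by (rule great)
    then show "u (t *\<^sub>R x) \<le> t * u x" using t by (simp add: field_simps)
  next
    have "q 0 = 0" if "q \<in> C" for q using C(2)[OF that] sublinear_0 by blast
    then have "(\<lambda>q. q 0) ` C = {0}" using C(1) by force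
    then show "u 0 = 0" by (simp add: u_def)
  qed
  then show "sublinear (\<lambda>x. INF q\<in>C. q x)" by (simp add: u_def[abs_def])
  show "(\<lambda>x. INF q\<in>C. q x) \<le> q" if "q \<in> C" for q
    using low[OF that] by (simp add: u_def le_fun_def)
qed

text \<open>Instead of extending functionals from subspaces, take a minimal sublinear functional; it
  is odd in every direction and therefore linear. Starting below \<open>p'\<close> rather than
  \<open>p\<close> builds in the bound \<open>- p h\<close> at \<open>- h\<close>, which forces the
  value \<open>p h\<close> at \<open>h\<close>.\<close>

lemma Hahn_Banach_sublinear:
  fixes p :: "'a::real_vector \<Rightarrow> real"
  assumes p: "sublinear p"
  obtains f where "linear f" "\<And>x. f x \<le> p x" "f h = p h"
proof -
  obtain p' where p': "sublinear p'" "\<And>x. p' x \<le> p x" "p' (- h) \<le> - p h"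
    using sublinear_directional[OF p] by blast
  define A where "A = {q. sublinear q \<and> q \<le> p'}"
  \<comment> \<open>The order is reversed, so that maximal elements are minimal functionals.\<close>
  define P where "P = (\<lambda>q r :: 'a \<Rightarrow> real. r \<le> q)"
  have "\<exists>m\<in>A. \<forall>a\<in>A. P m a \<longrightarrow> a = m"
  proof (rule predicate_Zorn)
    show "partial_order_on A (relation_of P A)"
      by (rule partial_order_on_relation_ofI) (auto simp: P_def)
    fix C assume "C \<in> Chains (relation_of P A)"
    then have CA: "C \<subseteq> A" and ch: "\<And>q r. q \<in> C \<Longrightarrow> r \<in> C \<Longrightarrow> q \<le> r \<or> r \<le> q"
      by (auto simp: Chains_def relation_of_def P_def)
    show "\<exists>u\<in>A. \<forall>a\<in>C. P a u"
    proof (cases "C = {}")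
      case True
      then show ?thesis using p' by (auto simp: A_def)
    next
      case False
      have *: "\<And>q. q \<in> C \<Longrightarrow> sublinear q \<and> q \<le> p'" using CA by (auto simp: A_def)
      note inf = sublinear_INF_chain[OF False * ch]
      have "(\<lambda>x. INF q\<in>C. q x) \<le> p'"
        using False inf(2) * order_trans by blast
      then show ?thesis using inf by (auto simp: A_def P_def)
    qed
  qed
  then obtain m where m: "sublinear m" "m \<le> p'"
    and min: "\<And>q. sublinear q \<Longrightarrow> q \<le> m \<Longrightarrow> q = m"
    unfolding A_def P_def by (auto intro: order_trans)
  have neg: "m (- x) = - m x" for x
  proof -
    obtain q where q: "sublinear q" "\<And>y. q y \<le> m y" "q (- x) \<le> - m x"
      using sublinear_directional[OF m(1)] by blast
    then have "q = m" by (intro min) (auto simp: le_fun_def)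
    then show ?thesis using q(3) sublinear_minus[OF m(1), of "x"] by simp
  qed
  have add: "m (x + y) = m x + m y" for x y
    using sublinear_add[OF m(1), of x y] sublinear_add[OF m(1), of "- x" "- y"]
      neg[of x] neg[of y] neg[of "x + y"] by simp
  have scale: "m (c *\<^sub>R x) = c *\<^sub>R m x" for c x
  proof (cases "c \<ge> 0")
    case True then show ?thesis using sublinear_scaleR[OF m(1)] by simp
  next
    case False
    then have "m ((- c) *\<^sub>R x) = (- c) * m x" by (intro sublinear_scaleR[OF m(1)]) simp
    then show ?thesis using neg[of "c *\<^sub>R x"] by simp
  qed
  have le: "m x \<le> p x" for x using m(2) p'(2)[of x] by (auto simp: le_fun_def intro: order_trans)
  have "m (- h) \<le> - p h" using m(2) p'(3) by (auto simp: le_fun_def intro: order_trans)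
  then have "m h = p h" using neg[of h] le[of h] by simp
  moreover have "linear m" by (rule linearI) (auto simp: add scale)
  ultimately show ?thesis using that le by blast
qed

lemma Hahn_Banach_bounded:
  fixes p :: "'a::real_normed_vector \<Rightarrow> real"
  assumes p: "sublinear p" and C: "\<And>x. p x \<le> C * norm x"
  obtains f :: "'a \<Rightarrow>\<^sub>L real" where "\<And>x. blinfun_apply f x \<le> p x" "blinfun_apply f h = p h"
proof -
  obtain f where f: "linear f" "\<And>x. f x \<le> p x" "f h = p h"
    using Hahn_Banach_sublinear[OF p] by blast
  interpret linear f by fact
  have "\<bar>f x\<bar> \<le> norm x * C" for x
    using order_trans[OF f(2) C, of x] order_trans[OF f(2) C, of "- x"] by (simp add: neg mult.commute)
  then have "bounded_linear f"
    by (intro bounded_linear_intro[where K = C]) (auto simp: add scale)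
  then show ?thesis using that[of "Blinfun f"] f by (simp add: bounded_linear_Blinfun_apply)
qed

lemma norming_functional:
  fixes h :: "'a::real_normed_vector"
  obtains f :: "'a \<Rightarrow>\<^sub>L real" where "\<And>x. blinfun_apply f x \<le> norm x" "blinfun_apply f h = norm h"
proof -
  have "sublinear (norm :: 'a \<Rightarrow> real)"
    by (rule sublinearI) (auto simp: norm_triangle_ineq)
  then show ?thesis using Hahn_Banach_bounded[of norm 1] that by auto
qed

text \<open>The distance to a subspace is sublinear and bounded by the norm. A functional dominated
  by it vanishes on \<open>Y\<close>, and it can be chosen to attain the distance at
  \<open>h\<close>, which is positive because \<open>Y\<close> is closed.\<close>

lemma separating_functional:
  fixes Y :: "'a::real_normed_vector set"
  assumes Y: "subspace Y" "closed Y" and h: "h \<notin> Y"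
  obtains f :: "'a \<Rightarrow>\<^sub>L real" where "\<And>y. y \<in> Y \<Longrightarrow> blinfun_apply f y = 0" "blinfun_apply f h > 0"
proof -
  have ne: "Y \<noteq> {}" using Y(1) subspace_0 by blast
  have less: "\<exists>y\<in>Y. dist x y < infdist x Y + e" if "e > 0" for x e
    using that cInf_lessD[of "dist x ` Y" "infdist x Y + e"] ne
    by (auto simp: infdist_notempty)
  have p: "sublinear (\<lambda>x. infdist x Y)"
  proof (rule sublinearI)
    fix x y
    show "infdist (x + y) Y \<le> infdist x Y + infdist y Y"
    proof (rule field_le_epsilon)
      fix e :: real assume "e > 0"
      then obtain a b where ab: "a \<in> Y" "b \<in> Y" "dist x a < infdist x Y + e/2" "dist y b < infdist y Y + e/2"
        using less[of "e/2" x] less[of "e/2" y] by auto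
      have "infdist (x + y) Y \<le> dist (x + y) (a + b)"
        using Y ab by (intro infdist_le subspace_add)
      also have "\<dots> \<le> dist x a + dist y b" by (rule dist_triangle_add)
      finally show "infdist (x + y) Y \<le> infdist x Y + infdist y Y + e" using ab by simp
    qed
  next
    fix t :: real and x :: 'a assume t: "t > 0"
    show "infdist (t *\<^sub>R x) Y \<le> t * infdist x Y"
    proof (rule field_le_epsilon)
      fix e :: real assume "e > 0"
      then obtain a where a: "a \<in> Y" "dist x a < infdist x Y + e/t"
        using less[of "e/t" x] t by auto
      have "infdist (t *\<^sub>R x) Y \<le> dist (t *\<^sub>R x) (t *\<^sub>R a)"
        using Y a by (intro infdist_le subspace_scale)
      also have "\<dots> = t * dist x a" using t by (simp add: dist_norm flip: scaleR_diff_right)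
      also have "\<dots> \<le> t * infdist x Y + e" using a t by (simp add: field_simps)
      finally show "infdist (t *\<^sub>R x) Y \<le> t * infdist x Y + e" .
    qed
  next
    show "infdist 0 Y = 0" using subspace_0[OF Y(1)] by simp
  qed
  have "infdist x Y \<le> 1 * norm x" for x
    using infdist_le[OF subspace_0[OF Y(1)], of x] by simp
  then obtain f :: "'a \<Rightarrow>\<^sub>L real" where f: "\<And>x. blinfun_apply f x \<le> infdist x Y" "blinfun_apply f h = infdist h Y"
    using Hahn_Banach_bounded[OF p] by blast
  show ?thesis
  proof
    fix y assume y: "y \<in> Y"
    then have "- y \<in> Y" using Y subspace_neg by blast
    then show "blinfun_apply f y = 0"
      using f(1)[of y] f(1)[of "- y"] y by (simp add: blinfun.minus_right)
  next
    have "infdist h Y > 0" using in_closed_iff_infdist_zero[OF Y(2) ne, of h] h infdist_nonneg[of h Y] by simp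
    then show "blinfun_apply f h > 0" using f(2) by simp
  qed
qed

subsection \<open>Weak sequential compactness\<close>

lemma subspace_closure:
  fixes S :: "'a::real_normed_vector set"
  assumes "subspace S"
  shows "subspace (closure S)"
proof (rule subspaceI)
  show "0 \<in> closure S"
    using subspace_0[OF assms] closure_subset by blast
  fix x y assume "x \<in> closure S" "y \<in> closure S"
  then obtain u v where u: "\<And>n. u n \<in> S" "u \<longlonglongrightarrow> x" and v: "\<And>n. v n \<in> S" "v \<longlonglongrightarrow> y"
    unfolding closure_sequential by blast
  have "\<forall>n. u n + v n \<in> S" using u v subspace_add[OF assms] by blast
  then show "x + y \<in> closure S"
    unfolding closure_sequential using tendsto_add[OF u(2) v(2)] by (intro exI conjI)
next
  fix c x assume "x \<in> closure S"
  then obtain u where u: "\<And>n. u n \<in> S" "u \<longlonglongrightarrow> x"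
    unfolding closure_sequential by blast
  have "\<forall>n. c *\<^sub>R u n \<in> S" using u subspace_scale[OF assms] by blast
  then show "c *\<^sub>R x \<in> closure S"
    unfolding closure_sequential using tendsto_scaleR[OF tendsto_const u(2)] by (intro exI conjI)
qed

text \<open>\<open>D\<close> consists of the rational combinations, coded as lists; the induction
  over the span replaces one real coefficient at a time by a rational one.\<close>

lemma countable_dense_span:
  fixes A :: "'a::real_normed_vector set"
  assumes "countable A"
  obtains D where "countable D" "span A \<subseteq> closure D"
proof -
  define f :: "(rat \<times> 'a) list \<Rightarrow> 'a"
    where "f l = sum_list (map (\<lambda>(q, a). of_rat q *\<^sub>R a) l)" for l
  define D where "D = f ` lists (UNIV \<times> A)"
  have "countable D"
    unfolding D_def using assms by (intro countable_image countable_lists countable_SIGMA) auto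
  moreover have "span A \<subseteq> closure D"
  proof
    fix x assume "x \<in> span A"
    then show "x \<in> closure D"
    proof (induction rule: span_induct_alt)
      case base
      have "f [] \<in> D" unfolding D_def by blast
      then show ?case using closure_subset by (auto simp: f_def)
    next
      case (step c a y)
      show ?case
      proof (rule closure_approachable[THEN iffD2], intro allI impI)
        fix e :: real assume e: "e > 0"
        \<comment> \<open>A coefficient error below \<open>d\<close> costs at most
          \<open>e / 2\<close>; the summand 1 keeps the denominator positive when
          \<open>a = 0\<close>.\<close>
        define d where "d = e / (2 * (norm a + 1))"
        have d: "d > 0" unfolding d_def using e norm_ge_zero[of a]
          by (intro divide_pos_pos mult_pos_pos) linarith+
        obtain q where q: "c < of_rat q" "of_rat q < c + d"
          using of_rat_dense[of c "c + d"] d by auto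
        obtain z where z: "z \<in> D" "dist z y < e / 2"
          using step.IH e closure_approachable[of y D] by (meson half_gt_zero)
        obtain l where l: "l \<in> lists (UNIV \<times> A)" "z = f l" using z unfolding D_def by auto
        have "(q, a) # l \<in> lists (UNIV \<times> A)" using l step.hyps by auto
        then have "f ((q, a) # l) \<in> D" unfolding D_def by blast
        then have in_D: "of_rat q *\<^sub>R a + z \<in> D" using l by (simp add: f_def)
        have "norm ((of_rat q - c) *\<^sub>R a) \<le> d * norm a"
          using q by (auto intro!: mult_right_mono)
        also have "\<dots> \<le> d * (norm a + 1)" using d by (intro mult_left_mono) auto
        also have "\<dots> = e / 2"
        proof -
          have "norm a + 1 \<noteq> 0" using norm_ge_zero[of a] by linarith
          then show ?thesis by (simp add: d_def field_simps)
        qed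
        finally have "dist (of_rat q *\<^sub>R a) (c *\<^sub>R a) \<le> e / 2"
          by (simp add: dist_norm scaleR_diff_left)
        then have "dist (of_rat q *\<^sub>R a + z) (c *\<^sub>R a + y) < e"
          using dist_triangle_add[of "of_rat q *\<^sub>R a" z "c *\<^sub>R a" y] z by linarith
        then show "\<exists>z\<in>D. dist z (c *\<^sub>R a + y) < e" using in_D by blast
      qed
    qed
  qed
  ultimately show ?thesis using that by blast
qed

text \<open>This is the limit superior; the real infimum is meaningful for bounded \<open>v\<close> only.\<close>
definition upper_limit :: "(nat \<Rightarrow> 'a::real_normed_vector) \<Rightarrow> ('a \<Rightarrow>\<^sub>L real) \<Rightarrow> real"
  where "upper_limit v \<psi> = Inf {c. \<forall>\<^sub>F n in sequentially. blinfun_apply \<psi> (v n) \<le> c}"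

context
  fixes v :: "nat \<Rightarrow> 'a::real_normed_vector" and M :: real
  assumes M: "\<And>n. norm (v n) \<le> M"
begin

lemma abs_blinfun_le: "\<bar>blinfun_apply \<psi> (v n)\<bar> \<le> M * norm \<psi>"
proof -
  have "norm (blinfun_apply \<psi> (v n)) \<le> norm \<psi> * norm (v n)" by (rule norm_blinfun)
  also have "\<dots> \<le> norm \<psi> * M" using M by (intro mult_left_mono) auto
  finally show ?thesis by (simp add: mult.commute)
qed

lemma upper_limit_le:
  assumes "\<forall>\<^sub>F n in sequentially. blinfun_apply \<psi> (v n) \<le> c"
  shows "upper_limit v \<psi> \<le> c"
  unfolding upper_limit_def
proof (rule cInf_lower)
  show "bdd_below {c. \<forall>\<^sub>F n in sequentially. blinfun_apply \<psi> (v n) \<le> c}"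
  proof (rule bdd_belowI)
    fix c assume "c \<in> {c. \<forall>\<^sub>F n in sequentially. blinfun_apply \<psi> (v n) \<le> c}"
    then obtain n where "blinfun_apply \<psi> (v n) \<le> c"
      by (auto simp: eventually_sequentially)
    then show "- (M * norm \<psi>) \<le> c" using abs_blinfun_le[of \<psi> n] by linarith
  qed
qed (use assms in auto)

lemma eventually_le_upper_limit:
  assumes "upper_limit v \<psi> < c"
  shows "\<forall>\<^sub>F n in sequentially. blinfun_apply \<psi> (v n) \<le> c"
proof -
  have "blinfun_apply \<psi> (v n) \<le> M * norm \<psi>" for n using abs_blinfun_le[of \<psi> n] by linarith
  then have "M * norm \<psi> \<in> {c. \<forall>\<^sub>F n in sequentially. blinfun_apply \<psi> (v n) \<le> c}" by simp
  then obtain d where d: "\<forall>\<^sub>F n in sequentially. blinfun_apply \<psi> (v n) \<le> d" "d < c"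
    using cInf_lessD[of "{c. \<forall>\<^sub>F n in sequentially. blinfun_apply \<psi> (v n) \<le> c}" c] assms
    unfolding upper_limit_def by blast
  show ?thesis using d(1) by eventually_elim (use d(2) in auto)
qed

lemma sublinear_upper_limit: "sublinear (upper_limit v)"
proof (rule sublinearI)
  fix \<phi> \<psi> :: "'a \<Rightarrow>\<^sub>L real"
  show "upper_limit v (\<phi> + \<psi>) \<le> upper_limit v \<phi> + upper_limit v \<psi>"
  proof (rule field_le_epsilon)
    fix e :: real assume e: "e > 0"
    have "\<forall>\<^sub>F n in sequentially. blinfun_apply (\<phi> + \<psi>) (v n) \<le> upper_limit v \<phi> + upper_limit v \<psi> + e"
      using eventually_le_upper_limit[of \<phi> "upper_limit v \<phi> + e/2", simplified, OF e]
        eventually_le_upper_limit[of \<psi> "upper_limit v \<psi> + e/2", simplified, OF e]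
      by eventually_elim (simp add: blinfun.add_left)
    then show "upper_limit v (\<phi> + \<psi>) \<le> upper_limit v \<phi> + upper_limit v \<psi> + e"
      by (rule upper_limit_le)
  qed
next
  fix t :: real and \<psi> :: "'a \<Rightarrow>\<^sub>L real" assume t: "t > 0"
  show "upper_limit v (t *\<^sub>R \<psi>) \<le> t * upper_limit v \<psi>"
  proof (rule field_le_epsilon)
    fix e :: real assume e: "e > 0"
    have "\<forall>\<^sub>F n in sequentially. blinfun_apply \<psi> (v n) \<le> upper_limit v \<psi> + e/t"
      using e t by (intro eventually_le_upper_limit) simp
    then have "\<forall>\<^sub>F n in sequentially. blinfun_apply (t *\<^sub>R \<psi>) (v n) \<le> t * upper_limit v \<psi> + e"
      by eventually_elim (use t in \<open>simp add: blinfun.scaleR_left field_simps\<close>)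
    then show "upper_limit v (t *\<^sub>R \<psi>) \<le> t * upper_limit v \<psi> + e" by (rule upper_limit_le)
  qed
next
  have "{c::real. 0 \<le> c} = {0..}" by auto
  then show "upper_limit v 0 = 0" by (simp add: upper_limit_def)
qed

lemma upper_limit_bound: "upper_limit v \<psi> \<le> M * norm \<psi>"
proof (rule upper_limit_le)
  have "blinfun_apply \<psi> (v n) \<le> M * norm \<psi>" for n using abs_blinfun_le[of \<psi> n] by linarith
  then show "\<forall>\<^sub>F n in sequentially. blinfun_apply \<psi> (v n) \<le> M * norm \<psi>" by simp
qed

text \<open>Hahn-Banach on the dual space, below the limit superior, yields an element of the
  bidual, which reflexivity turns into a point. Such a point plays the role of a weak cluster point,
  and the limit superior along one prescribed \<open>\<phi>\<close> can be attained.\<close>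

lemma ex_weak_cluster_point:
  assumes "reflexive_space TYPE('a)"
  obtains z where "\<And>\<psi>. blinfun_apply \<psi> z \<le> upper_limit v \<psi>" "blinfun_apply \<phi> z = upper_limit v \<phi>"
proof -
  obtain F :: "('a \<Rightarrow>\<^sub>L real) \<Rightarrow>\<^sub>L real" where
    F: "\<And>\<psi>. blinfun_apply F \<psi> \<le> upper_limit v \<psi>" "blinfun_apply F \<phi> = upper_limit v \<phi>"
    using Hahn_Banach_bounded[OF sublinear_upper_limit upper_limit_bound, of \<phi>] by auto
  obtain z :: 'a where "F = blinfun.prod_left z"
    using assms unfolding reflexive_space_def by (metis surjD)
  then show ?thesis using F that[of z] by simp
qed

end

text \<open>The diagonal subsequence converges along the norming functionals of a countable dense subset
  of the closed span \<open>Y\<close>. These functionals separate points of \<open>Y\<close>, so there is only one weak cluster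
  point, and the limits superior of all functionals are attained there.\<close>
lemma weakly_convergent_subsequence:
  fixes u :: "nat \<Rightarrow> 'a::real_normed_vector"
  assumes refl: "reflexive_space TYPE('a)" and bdd: "bounded (range u)"
  obtains r z where "strict_mono r" "weakly_converges (u \<circ> r) z"
proof -
  obtain M where M: "\<And>n. norm (u n) \<le> M" using bdd by (auto simp: bounded_iff)
  define Y where "Y = closure (span (range u))"
  have Y: "subspace Y" "closed Y" unfolding Y_def by (auto intro: subspace_closure)
  have uY: "u n \<in> Y" for n
    unfolding Y_def by (intro subsetD[OF closure_subset] span_base) simp
  obtain D where D: "countable D" "span (range u) \<subseteq> closure D"
    using countable_dense_span[of "range u"] by auto
  have YD: "Y \<subseteq> closure D" unfolding Y_def using D(2) closure_minimal by blast
  then have "D \<noteq> {}" using uY by auto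
  define \<Phi> :: "'a \<Rightarrow> ('a \<Rightarrow>\<^sub>L real)"
    where "\<Phi> d = (SOME f. (\<forall>x. blinfun_apply f x \<le> norm x) \<and> blinfun_apply f d = norm d)" for d
  have \<Phi>: "blinfun_apply (\<Phi> d) x \<le> norm x" "blinfun_apply (\<Phi> d) d = norm d" for d x
  proof -
    have "\<exists>f :: 'a \<Rightarrow>\<^sub>L real. (\<forall>x. blinfun_apply f x \<le> norm x) \<and> blinfun_apply f d = norm d"
      by (metis norming_functional)
    from someI_ex[OF this] show "blinfun_apply (\<Phi> d) x \<le> norm x" "blinfun_apply (\<Phi> d) d = norm d"
      unfolding \<Phi>_def by auto
  qed
  define P where "P n s \<longleftrightarrow> convergent (\<lambda>k. blinfun_apply (\<Phi> (from_nat_into D n)) (u (s k)))"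
    for n and s :: "nat \<Rightarrow> nat"
  interpret subseqs P
  proof
    fix n and s :: "nat \<Rightarrow> nat"
    let ?g = "\<lambda>k. blinfun_apply (\<Phi> (from_nat_into D n)) (u (s k))"
    have "\<bar>?g k\<bar> \<le> M * norm (\<Phi> (from_nat_into D n))" for k
      by (rule abs_blinfun_le[OF M])
    then have "bounded (range ?g)" by (auto simp: bounded_iff)
    then obtain l r where "strict_mono r" "(?g \<circ> r) \<longlonglongrightarrow> l"
      using bounded_imp_convergent_subsequence by blast
    then show "\<exists>r'. strict_mono r' \<and> P n (s \<circ> r')"
      by (auto simp: P_def convergent_def o_def)
  qed
  define v where "v = u \<circ> diagseq"
  have Mv: "norm (v n) \<le> M" for n using M by (simp add: v_def)
  have conv: "convergent (\<lambda>k. blinfun_apply (\<Phi> d) (v k))" if d: "d \<in> D" for d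
  proof -
    obtain n where n: "d = from_nat_into D n"
      using d D(1) from_nat_into_surj by metis
    \<comment> \<open>From index \<open>Suc n\<close> on, the diagonal sequence refines a sequence
      with property \<open>P n\<close>; convergence ignores the dropped initial segment.\<close>
    have "P n (diagseq \<circ> ((+) (Suc n)))"
    proof (rule diagseq_holds)
      fix r s :: "nat \<Rightarrow> nat" and n assume "strict_mono r" "P n s"
      then show "P n (s \<circ> r)"
        unfolding P_def
        using convergent_subseq_convergent[of "\<lambda>k. blinfun_apply (\<Phi> (from_nat_into D n)) (u (s k))" r]
        by (simp add: o_def)
    qed
    then have "convergent (\<lambda>k. blinfun_apply (\<Phi> d) (v (k + Suc n)))"
      by (simp add: P_def n v_def o_def add.commute)
    then show ?thesis
      using convergent_ignore_initial_segment[of "\<lambda>k. blinfun_apply (\<Phi> d) (v k)" "Suc n"] by simp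
  qed
  note upper_le = upper_limit_le[of v M, OF Mv]
  have unique: "z1 = z2"
    if z1: "\<And>\<psi>. blinfun_apply \<psi> z1 \<le> upper_limit v \<psi>" and z2: "\<And>\<psi>. blinfun_apply \<psi> z2 \<le> upper_limit v \<psi>"
    for z1 z2
  proof (rule ccontr)
    have inY: "z \<in> Y" if z: "\<And>\<psi>. blinfun_apply \<psi> z \<le> upper_limit v \<psi>" for z
    proof (rule ccontr)
      assume "z \<notin> Y"
      then obtain \<psi> :: "'a \<Rightarrow>\<^sub>L real" where \<psi>: "\<And>y. y \<in> Y \<Longrightarrow> blinfun_apply \<psi> y = 0" "blinfun_apply \<psi> z > 0"
        using separating_functional[OF Y] by blast
      have "upper_limit v \<psi> \<le> 0" by (rule upper_le) (simp add: \<psi>(1) uY v_def)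
      then show False using z[of \<psi>] \<psi>(2) by simp
    qed
    \<comment> \<open>Since \<open>v\<close> converges along \<open>\<Phi> d\<close>, the bounds for
      this functional and for its negative pin down the value at \<open>z\<close>.\<close>
    have eq: "blinfun_apply (\<Phi> d) z = lim (\<lambda>k. blinfun_apply (\<Phi> d) (v k))"
      if d: "d \<in> D" and z: "\<And>\<psi>. blinfun_apply \<psi> z \<le> upper_limit v \<psi>" for d z
    proof -
      let ?L = "lim (\<lambda>k. blinfun_apply (\<Phi> d) (v k))"
      have lim: "(\<lambda>k. blinfun_apply (\<Phi> d) (v k)) \<longlonglongrightarrow> ?L"
        using conv[OF d] by (simp add: convergent_LIMSEQ_iff)
      have "\<bar>blinfun_apply (\<Phi> d) z - ?L\<bar> \<le> 0 + e" if e: "e > 0" for e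
      proof -
        have ev: "\<forall>\<^sub>F k in sequentially. dist (blinfun_apply (\<Phi> d) (v k)) ?L < e"
          using tendstoD[OF lim e] .
        have "upper_limit v (\<Phi> d) \<le> ?L + e"
          by (rule upper_le) (use ev in \<open>eventually_elim, auto simp: dist_real_def\<close>)
        moreover have "upper_limit v (- \<Phi> d) \<le> - ?L + e"
          by (rule upper_le) (use ev in \<open>eventually_elim, auto simp: dist_real_def blinfun.minus_left\<close>)
        ultimately show ?thesis
          using z[of "\<Phi> d"] z[of "- \<Phi> d"] by (simp add: blinfun.minus_left)
      qed
      then have "\<bar>blinfun_apply (\<Phi> d) z - ?L\<bar> \<le> 0" by (rule field_le_epsilon)
      then show ?thesis by simp
    qed
    assume "z1 \<noteq> z2"
    define w where "w = z1 - z2"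
    have w: "w \<in> Y" "norm w > 0"
      using \<open>z1 \<noteq> z2\<close> inY[OF z1] inY[OF z2] Y by (auto simp: w_def intro: subspace_diff)
    then obtain d where d: "d \<in> D" "dist d w < norm w / 2"
      using YD closure_approachable[of w D] by (meson half_gt_zero subsetD)
    \<comment> \<open>\<open>\<Phi> d\<close> agrees at \<open>z1\<close> and \<open>z2\<close>, so
      it vanishes at \<open>w\<close>. But it norms \<open>d\<close>, which is close to
      \<open>w\<close>, so \<open>w\<close> would have to be too short.\<close>
    have "norm d = blinfun_apply (\<Phi> d) (d - w)"
      using eq[OF d(1) z1] eq[OF d(1) z2] \<Phi>(2)[of d] by (simp add: w_def blinfun.diff_right)
    also have "\<dots> \<le> norm (d - w)" by (rule \<Phi>)
    finally have "norm d < norm w / 2" using d by (simp add: dist_norm)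
    moreover have "norm w \<le> norm d + norm (d - w)"
      using norm_triangle_ineq4[of d "d - w"] by simp
    ultimately show False using d by (simp add: dist_norm)
  qed
  obtain z where z: "\<And>\<psi>. blinfun_apply \<psi> z \<le> upper_limit v \<psi>"
    using ex_weak_cluster_point[of v M, OF Mv refl] by metis
  \<comment> \<open>For each \<open>\<psi>\<close> some cluster point attains the limit superior; by
    uniqueness it is always \<open>z\<close>.\<close>
  have attained: "blinfun_apply \<psi> z = upper_limit v \<psi>" for \<psi>
    using ex_weak_cluster_point[of v M \<psi>, OF Mv refl] unique[OF z] by metis
  have "weakly_converges v z"
    unfolding weakly_converges_def
  proof (intro allI tendstoI)
    fix \<phi> :: "'a \<Rightarrow>\<^sub>L real" and e :: real assume e: "e > 0"
    have "\<forall>\<^sub>F n in sequentially. blinfun_apply \<phi> (v n) \<le> blinfun_apply \<phi> z + e/2"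
      using e by (intro eventually_le_upper_limit[of v M, OF Mv]) (simp flip: attained)
    \<comment> \<open>The negative functional controls the limit inferior.\<close>
    moreover have "\<forall>\<^sub>F n in sequentially. blinfun_apply (- \<phi>) (v n) \<le> blinfun_apply (- \<phi>) z + e/2"
      using e by (intro eventually_le_upper_limit[of v M, OF Mv]) (simp flip: attained)
    ultimately show "\<forall>\<^sub>F n in sequentially. dist (blinfun_apply \<phi> (v n)) (blinfun_apply \<phi> z) < e"
      by eventually_elim (use e in \<open>auto simp: dist_real_def blinfun.minus_left abs_if\<close>)
  qed
  then show ?thesis using that[OF subseq_diagseq] by (simp add: v_def)
qed

section \<open>Existence of minimisers\<close>

lemma seq_weakly_lsc_add_blinfun:
  assumes "seq_weakly_lsc f"
  shows "seq_weakly_lsc (\<lambda>x. f x + blinfun_apply \<phi> x)"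
  unfolding seq_weakly_lsc_def
proof (intro allI impI)
  fix u :: "nat \<Rightarrow> 'a" and x assume w: "weakly_converges u x"
  then have lim: "(\<lambda>n. ereal (blinfun_apply \<phi> (u n))) \<longlonglongrightarrow> ereal (blinfun_apply \<phi> x)"
    by (simp add: weakly_converges_def)
  have "liminf (\<lambda>n. ereal (blinfun_apply \<phi> (u n)) + ereal (f (u n)))
      = ereal (blinfun_apply \<phi> x) + liminf (\<lambda>n. ereal (f (u n)))"
    by (rule ereal_liminf_lim_add[OF lim]) simp
  moreover have "ereal (f x) \<le> liminf (\<lambda>n. ereal (f (u n)))"
    using assms w by (simp add: seq_weakly_lsc_def)
  ultimately show "ereal (f x + blinfun_apply \<phi> x) \<le> liminf (\<lambda>n. ereal (f (u n) + blinfun_apply \<phi> (u n)))"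
    by (simp add: add.commute[of "f _"]) (metis add_left_mono plus_ereal.simps(1))
qed

text \<open>The direct method: coercivity bounds a tail of a minimising sequence, reflexivity gives
  a weakly convergent subsequence, and semicontinuity shows that its limit is a minimiser.\<close>

lemma coercive_weakly_lsc_attains_min:
  fixes f :: "'a::real_normed_vector \<Rightarrow> real"
  assumes refl: "reflexive_space TYPE('a)" and lsc: "seq_weakly_lsc f" and coer: "coercive f"
  obtains x where "\<And>z. f x \<le> f z"
proof -
  \<comment> \<open>The infimum is taken in the extended reals, so no lower bound of
    \<open>f\<close> has to be known beforehand.\<close>
  let ?A = "range (\<lambda>x. ereal (f x))"
  obtain g where g: "\<And>n. g n \<in> ?A" "g \<longlonglongrightarrow> Inf ?A"
    using Inf_as_limit[of ?A] by auto
  then have "\<forall>n. \<exists>x. g n = ereal (f x)" by blast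
  then obtain u where u: "\<And>n. g n = ereal (f (u n))" by metis
  obtain b where b: "\<And>x. norm x \<ge> b \<Longrightarrow> f x \<ge> f 0 + 1"
    using coer unfolding coercive_def filterlim_at_top eventually_at_infinity by metis
  have "Inf ?A < ereal (f 0 + 1)"
    by (rule le_less_trans[of _ "ereal (f 0)"]) (auto intro: Inf_lower)
  then have "\<forall>\<^sub>F n in sequentially. g n < ereal (f 0 + 1)"
    using g(2) by (rule order_tendstoD(2)[rotated])
  then obtain N where N: "\<And>n. n \<ge> N \<Longrightarrow> f (u n) < f 0 + 1"
    by (auto simp: eventually_sequentially u)
  define v where "v n = u (n + N)" for n
  have "norm (v n) \<le> b" for n
    using b[of "v n"] N[of "n + N"] by (force simp: v_def)
  then have "bounded (range v)" by (auto simp: bounded_iff)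
  then obtain r z where r: "strict_mono r" "weakly_converges (v \<circ> r) z"
    using weakly_convergent_subsequence[OF refl] by blast
  have "(\<lambda>n. ereal (f (v n))) \<longlonglongrightarrow> Inf ?A"
    using LIMSEQ_ignore_initial_segment[OF g(2), of N] by (simp add: u v_def)
  then have "(\<lambda>n. ereal (f ((v \<circ> r) n))) \<longlonglongrightarrow> Inf ?A"
    using LIMSEQ_subseq_LIMSEQ[OF _ r(1)] by (fastforce simp: o_def)
  then have "liminf (\<lambda>n. ereal (f ((v \<circ> r) n))) = Inf ?A"
    by (intro lim_imp_Liminf) auto
  moreover have "ereal (f z) \<le> liminf (\<lambda>n. ereal (f ((v \<circ> r) n)))"
    using lsc r(2) unfolding seq_weakly_lsc_def by blast
  ultimately have *: "ereal (f z) \<le> Inf ?A" by simp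
  have "f z \<le> f y" for y
    using order_trans[OF *, of "ereal (f y)"] by (simp add: Inf_lower)
  then show ?thesis using that by blast
qed

subsection \<open>\<open>\<sigma>\<close>-compact sets and proper maps\<close>

text \<open>When \<open>a\<close> is new, a functional that vanishes on \<open>span E\<close> but
  not at \<open>a\<close> reads off the coefficient of \<open>a\<close>. Subtracting that component
  is continuous, and the larger span is the preimage of \<open>span E\<close> under this
  map.\<close>

lemma closed_span_finite:
  fixes E :: "'a::real_normed_vector set"
  assumes "finite E"
  shows "closed (span E)"
  using assms
proof induction
  case (insert a E)
  show ?case
  proof (cases "a \<in> span E")
    case True
    then show ?thesis using insert.IH by (simp add: span_redundant)
  next
    case False
    then obtain f :: "'a \<Rightarrow>\<^sub>L real"
      where f: "\<And>y. y \<in> span E \<Longrightarrow> blinfun_apply f y = 0" "blinfun_apply f a > 0"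
      using separating_functional[OF subspace_span insert.IH] by blast
    have "span (insert a E) = (\<lambda>x. x - (blinfun_apply f x / blinfun_apply f a) *\<^sub>R a) -` span E"
    proof (rule set_eqI)
      fix x
      have "k = blinfun_apply f x / blinfun_apply f a" if "x - k *\<^sub>R a \<in> span E" for k
        using f(1)[OF that] f(2) by (simp add: blinfun.diff_right blinfun.scaleR_right field_simps)
      then show "x \<in> span (insert a E)
          \<longleftrightarrow> x \<in> (\<lambda>x. x - (blinfun_apply f x / blinfun_apply f a) *\<^sub>R a) -` span E"
        by (auto simp: span_breakdown_eq)
    qed
    moreover have "closed ((\<lambda>x. x - (blinfun_apply f x / blinfun_apply f a) *\<^sub>R a) -` span E)"
      using f(2) by (intro closed_vimage insert.IH continuous_intros) auto
    ultimately show ?thesis by simp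
  qed
qed simp

text \<open>Riesz's lemma: a functional vanishing on the finite-dimensional span \<open>Y\<close> of a fine net of a ball
  would have norm at most half of itself.\<close>
lemma compact_interior_empty:
  fixes K :: "'a::real_normed_vector set"
  assumes inf: "infinite_dimensional TYPE('a)" and K: "compact K"
  shows "interior K = {}"
proof (rule ccontr)
  assume "interior K \<noteq> {}"
  then obtain x e where e: "e > 0" "ball x e \<subseteq> K"
    by (meson all_not_in_conv mem_interior)
  obtain C where C: "finite C" "K \<subseteq> (\<Union>c\<in>C. ball c (e/4))"
    using compactE_image[OF K, of K "\<lambda>c. ball c (e/4)"] e(1) by (metis UN_I centre_in_ball divide_pos_pos open_ball subsetI zero_less_numeral)
  let ?Y = "span (insert x C)"
  have "?Y \<noteq> UNIV" using inf C(1) unfolding infinite_dimensional_def by blast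
  then obtain v where v: "v \<notin> ?Y" by blast
  have "closed ?Y" using C(1) by (intro closed_span_finite) simp
  then obtain f :: "'a \<Rightarrow>\<^sub>L real"
    where f: "\<And>y. y \<in> ?Y \<Longrightarrow> blinfun_apply f y = 0" "blinfun_apply f v > 0"
    using separating_functional[OF subspace_span _ v] by blast
  \<comment> \<open>\<open>f\<close> vanishes at \<open>x\<close> and at the points of the net, so
    on a ball of radius \<open>e\<close> only the distance to the net, below \<open>e/4\<close>,
    matters.\<close>
  have small: "\<bar>blinfun_apply f w\<bar> \<le> norm f * (e/4)" if w: "norm w < e" for w
  proof -
    have "x + w \<in> K" using e w by (auto simp: subset_iff dist_norm)
    then obtain c where c: "c \<in> C" "dist c (x + w) < e/4" using C(2) by auto
    have "blinfun_apply f w = blinfun_apply f (x + w - c)"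
      using f(1)[of x] f(1)[of c] c by (simp add: blinfun.diff_right blinfun.add_right span_base)
    also have "\<bar>\<dots>\<bar> \<le> norm f * norm (x + w - c)"
      using norm_blinfun[of f "x + w - c"] by simp
    also have "\<dots> \<le> norm f * (e/4)"
      using c by (intro mult_left_mono) (auto simp: dist_norm norm_minus_commute)
    finally show ?thesis .
  qed
  have "norm f \<le> norm f / 2"
  proof (rule norm_blinfun_bound)
    fix w
    show "norm (blinfun_apply f w) \<le> norm f / 2 * norm w"
    proof (cases "w = 0")
      case False
      \<comment> \<open>The rescaled vector has norm \<open>e/2\<close>, and \<open>e/4\<close> is
        half of that.\<close>
      define c where "c = e / (2 * norm w)"
      have c: "c > 0" using False e by (simp add: c_def)
      have "norm (c *\<^sub>R w) < e" using False e by (simp add: c_def)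
      from small[OF this] have "c * \<bar>blinfun_apply f w\<bar> \<le> norm f * (e/4)"
        using c by (simp add: blinfun.scaleR_right abs_mult)
      then show ?thesis using False e by (simp add: c_def field_simps)
    qed simp
  qed simp
  then have "f = 0" by simp
  then show False using f(2) by simp
qed

section \<open>Sigma-compact sets and how to avoid them\<close>

lemma compact_imp_sigma_compact: "compact K \<Longrightarrow> sigma_compact K"
  unfolding sigma_compact_def by (intro exI[of _ "{K}"]) auto

lemma sigma_compact_UN:
  assumes "countable I" "\<And>i. i \<in> I \<Longrightarrow> sigma_compact (A i)"
  shows "sigma_compact (\<Union>i\<in>I. A i)"
proof -
  obtain \<K> where \<K>: "\<And>i. i \<in> I \<Longrightarrow> countable (\<K> i) \<and> (\<forall>K\<in>\<K> i. compact K) \<and> A i = \<Union>(\<K> i)"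
    using assms(2) unfolding sigma_compact_def by metis
  show ?thesis
    unfolding sigma_compact_def
    using \<K> assms(1) by (intro exI[of _ "\<Union>i\<in>I. \<K> i"]) auto
qed

lemma sigma_compact_Un:
  assumes "sigma_compact S" "sigma_compact S'"
  shows "sigma_compact (S \<union> S')"
  using sigma_compact_UN[of "{S, S'}" "\<lambda>x. x"] assms by auto

lemma sigma_compact_closed_Int:
  fixes S :: "'a::t2_space set"
  assumes "sigma_compact S" "closed C"
  shows "sigma_compact (C \<inter> S)"
proof -
  obtain \<K> where "countable \<K>" "\<forall>K\<in>\<K>. compact K" "S = \<Union>\<K>"
    using assms(1) by (auto simp: sigma_compact_def)
  then show ?thesis
    unfolding sigma_compact_def using assms(2)
    by (intro exI[of _ "(\<inter>) C ` \<K>"]) (auto intro: closed_Int_compact)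
qed

lemma sigma_compact_image:
  assumes "sigma_compact S" "continuous_on S f"
  shows "sigma_compact (f ` S)"
proof -
  obtain \<K> where \<K>: "countable \<K>" "\<forall>K\<in>\<K>. compact K" "S = \<Union>\<K>"
    using assms(1) by (auto simp: sigma_compact_def)
  then have "compact (f ` K)" if "K \<in> \<K>" for K
    using that assms(2) by (intro compact_continuous_image) (auto intro: continuous_on_subset)
  then show ?thesis
    unfolding sigma_compact_def using \<K> by (intro exI[of _ "(`) f ` \<K>"]) auto
qed

lemma sigma_compact_Times:
  assumes "sigma_compact S" "sigma_compact S'"
  shows "sigma_compact (S \<times> S')"
proof -
  obtain \<K> \<K>' where "countable \<K>" "\<forall>K\<in>\<K>. compact K" "S = \<Union>\<K>"
    and "countable \<K>'" "\<forall>K\<in>\<K>'. compact K" "S' = \<Union>\<K>'"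
    using assms by (auto simp: sigma_compact_def)
  then show ?thesis
    unfolding sigma_compact_def
    by (intro exI[of _ "(\<lambda>(K, K'). K \<times> K') ` (\<K> \<times> \<K>')"]) (auto intro: compact_Times)
qed

text \<open>The range of the cone parameter: 0 is left out because the apex cannot be solved for
  there.\<close>

lemma sigma_compact_greaterThanAtMost: "sigma_compact {0<..1::real}"
proof -
  have "{0<..1::real} = (\<Union>n. {1 / real (Suc n)..1})"
  proof (intro equalityI subsetI)
    fix t :: real assume t: "t \<in> {0<..1}"
    then obtain n where "1 / real (Suc n) < t" using nat_approx_posE[of t] by auto
    then show "t \<in> (\<Union>n. {1 / real (Suc n)..1})" using t by (intro UN_I[of n]) auto
  next
    fix t assume "t \<in> (\<Union>n. {1 / real (Suc n)..1})"
    then obtain n where *: "1 / real (Suc n) \<le> t" "t \<le> 1" by (auto simp del: of_nat_Suc)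
    have "0 < 1 / real (Suc n)" by simp
    then have "0 < t" using *(1) by (rule less_le_trans)
    then show "t \<in> {0<..1}" using *(2) by simp
  qed
  moreover have "sigma_compact (\<Union>n. {1 / real (Suc n)..1})"
    by (intro sigma_compact_UN compact_imp_sigma_compact compact_Icc) simp
  ultimately show ?thesis by simp
qed

text \<open>Baire's theorem. The smallness of compact sets is a hypothesis rather than a dimension
  condition, so that the result serves both \<open>X\<close> and its dual.\<close>

lemma sigma_compact_interior_empty:
  fixes S :: "'a::{complete_space, metric_space} set"
  assumes K: "\<And>K :: 'a set. compact K \<Longrightarrow> interior K = {}" and S: "sigma_compact S"
  shows "interior S = {}"
proof -
  obtain \<K> where \<K>: "countable \<K>" "\<forall>K\<in>\<K>. compact K" "S = \<Union>\<K>"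
    using S by (auto simp: sigma_compact_def)
  have "euclidean interior_of \<Union>\<K> = {}"
    using \<K> K completely_metrizable_space_euclidean
    by (intro Baire_category_alt) (auto simp: compact_imp_closed)
  then show ?thesis using \<K>(3) by simp
qed

text \<open>The apices \<open>c\<close> of cones over \<open>K\<close> that meet \<open>D\<close> form a \<open>\<sigma>\<close>-compact set: solve
  \<open>(1 - t) a + t c = d\<close> for \<open>c\<close>.\<close>
lemma cone_avoiding_sigma_compact:
  fixes D K :: "'a::banach set"
  assumes nc: "\<And>K :: 'a set. compact K \<Longrightarrow> interior K = {}"
    and D: "sigma_compact D" and K: "compact K" "K \<inter> D = {}"
  obtains c where "\<And>a. a \<in> K \<Longrightarrow> closed_segment a c \<inter> D = {}"
proof -
  define g :: "'a \<times> real \<times> 'a \<Rightarrow> 'a"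
    where "g = (\<lambda>(d, t, a). (1 / t) *\<^sub>R (d - (1 - t) *\<^sub>R a))"
  have "continuous_on (D \<times> {0<..1} \<times> K) g"
    unfolding g_def case_prod_beta by (intro continuous_intros) auto
  then have "sigma_compact (g ` (D \<times> {0<..1} \<times> K))"
    by (intro sigma_compact_image sigma_compact_Times sigma_compact_greaterThanAtMost
        compact_imp_sigma_compact[OF K(1)] D)
  then have "interior (g ` (D \<times> {0<..1} \<times> K)) = {}"
    using sigma_compact_interior_empty nc by blast
  then have "g ` (D \<times> {0<..1} \<times> K) \<noteq> UNIV" by auto
  then obtain c where c: "c \<notin> g ` (D \<times> {0<..1} \<times> K)" by blast
  have "(1 - t) *\<^sub>R a + t *\<^sub>R c \<notin> D" if a: "a \<in> K" and t: "t \<in> {0..1}" for a t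
  proof
    assume *: "(1 - t) *\<^sub>R a + t *\<^sub>R c \<in> D"
    then have "t \<noteq> 0" using K(2) a by auto
    then have "g ((1 - t) *\<^sub>R a + t *\<^sub>R c, t, a) = c" by (simp add: g_def)
    moreover have "((1 - t) *\<^sub>R a + t *\<^sub>R c, t, a) \<in> D \<times> {0<..1} \<times> K"
      using a t \<open>t \<noteq> 0\<close> * by auto
    ultimately show False using c by (metis image_eqI)
  qed
  then show ?thesis using that[of c] by (force simp: in_segment)
qed

text \<open>A cone over the two points \<open>a\<close> and \<open>b\<close> is a broken line
  through its apex.\<close>

lemma path_avoiding_sigma_compact:
  fixes D :: "'a::banach set"
  assumes nc: "\<And>K :: 'a set. compact K \<Longrightarrow> interior K = {}"
    and D: "sigma_compact D" "a \<notin> D" "b \<notin> D"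
  obtains g where "path g" "path_image g \<inter> D = {}" "pathstart g = a" "pathfinish g = b"
proof -
  obtain c where "\<And>x. x \<in> {a, b} \<Longrightarrow> closed_segment x c \<inter> D = {}"
    using cone_avoiding_sigma_compact[OF nc D(1), of "{a, b}"] D by auto
  then have "closed_segment a c \<inter> D = {}" "closed_segment b c \<inter> D = {}" by auto
  then show ?thesis
    by (intro that[of "linepath a c +++ linepath c b"])
       (auto simp: path_image_join closed_segment_commute)
qed

section \<open>Closed maps and proper maps\<close>

text \<open>Approximate the boundary points \<open>x n\<close> by points \<open>z n\<close> off the
  fibre whose images tend to \<open>y\<close>. Without a limit point, \<open>range z\<close> would
  be closed, and then so would its image, which would contain \<open>y\<close>. Hence
  \<open>z\<close> has a convergent subsequence, and \<open>x\<close> follows it.\<close>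

lemma closed_map_compact_frontier_fibre:
  fixes f :: "'a::real_normed_vector \<Rightarrow> 'b::metric_space"
  assumes cont: "continuous_on UNIV f" and cl: "closed_map euclidean euclidean f"
  shows "compact (frontier (f -` {y}))"
  unfolding compact_eq_seq_compact_metric
proof (rule seq_compactI)
  fix x :: "nat \<Rightarrow> 'a"
  assume x: "\<forall>n. x n \<in> frontier (f -` {y})"
  have "closed (f -` {y})" using cont by (simp add: closed_vimage)
  then have fx: "f (x n) = y" for n using x frontier_subset_closed by blast
  have "\<exists>z. f z \<noteq> y \<and> dist z (x n) < 1 / Suc n \<and> dist (f z) y < 1 / Suc n" for n
  proof -
    have "(0::real) < 1 / Suc n" by simp
    then obtain d where d: "d > 0" "\<And>z. dist z (x n) < d \<Longrightarrow> dist (f z) (f (x n)) < 1 / Suc n"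
      using cont unfolding continuous_on_iff by (metis UNIV_I)
    have "0 < min d (1 / Suc n)" using d(1) by simp
    then obtain z where "z \<notin> f -` {y}" "dist (x n) z < min d (1 / Suc n)"
      using x unfolding frontier_straddle by (metis (mono_tags, lifting) mem_Collect_eq)
    then show ?thesis using d(2)[of z] fx[of n]
      by (intro exI[of _ z]) (auto simp: dist_commute)
  qed
  then obtain z where z: "\<And>n. f (z n) \<noteq> y" "\<And>n. dist (z n) (x n) < 1 / Suc n"
    "\<And>n. dist (f (z n)) y < 1 / Suc n"
    by metis
  have to0: "(\<lambda>n. 1 / real (Suc n)) \<longlonglongrightarrow> 0"
    using LIMSEQ_inverse_real_of_nat by (simp add: inverse_eq_divide)
  have fz: "(\<lambda>n. f (z n)) \<longlonglongrightarrow> y"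
    by (rule metric_tendsto_imp_tendsto[OF to0]) (simp add: z(3) less_imp_le del: of_nat_Suc)
  have "\<exists>l. l islimpt range z"
  proof (rule ccontr)
    assume "\<nexists>l. l islimpt range z"
    then have "closed (range z)" by (simp add: closed_limpt)
    then have "closed (f ` range z)" using cl by (simp add: closed_map_def)
    then have "y \<in> f ` range z"
      by (rule closed_sequentially[OF _ _ fz]) auto
    then show False using z(1) by auto
  qed
  then obtain l r where r: "strict_mono r" "(z \<circ> r) \<longlonglongrightarrow> l"
    using islimpt_range_imp_convergent_subsequence by blast
  have "(\<lambda>n. 1 / real (Suc (r n))) \<longlonglongrightarrow> 0"
    using LIMSEQ_subseq_LIMSEQ[OF to0 r(1)] by (simp add: o_def)
  then have "(\<lambda>n. x (r n) - z (r n)) \<longlonglongrightarrow> 0"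
    by (rule Lim_null_comparison[rotated])
       (use z(2) in \<open>simp add: less_imp_le norm_minus_commute[of "x _"] dist_norm del: of_nat_Suc\<close>)
  then have lim: "(x \<circ> r) \<longlonglongrightarrow> l"
    using Lim_transform[OF r(2)[unfolded o_def], of "\<lambda>n. x (r n)"] by (simp add: o_def)
  then have "l \<in> frontier (f -` {y})"
    by (rule closed_sequentially[OF frontier_closed, rotated]) (use x in auto)
  then show "\<exists>l\<in>frontier (f -` {y}). \<exists>r. strict_mono r \<and> (x \<circ> r) \<longlonglongrightarrow> l"
    using r(1) lim by blast
qed

text \<open>The compact boundary of a fibre does not separate the space, hence a nonconstant map has
  fibres without interior.\<close>
lemma closed_map_imp_proper_map:
  fixes f :: "'a::banach \<Rightarrow> 'b::metric_space"
  assumes nc: "\<And>K :: 'a set. compact K \<Longrightarrow> interior K = {}"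
    and cont: "continuous_on UNIV f" and cl: "closed_map euclidean euclidean f"
    and nonconst: "\<nexists>c. \<forall>x. f x = c"
  shows "proper_map euclidean euclidean f"
proof -
  have "compact (f -` {y})" for y
  proof -
    let ?F = "f -` {y}"
    have comp: "compact (frontier ?F)" by (rule closed_map_compact_frontier_fibre[OF cont cl])
    have "interior ?F = {}"
    proof (rule ccontr)
      assume "interior ?F \<noteq> {}"
      then obtain a where a: "a \<in> interior ?F" by blast
      obtain b where b: "b \<notin> ?F" using nonconst by auto
      have cl: "closed ?F" using cont by (simp add: closed_vimage)
      \<comment> \<open>The boundary is compact, so a path from inside the fibre to a point off it
        can avoid the boundary, which connectedness forbids.\<close>
      obtain g where g: "path g" "path_image g \<inter> frontier ?F = {}" "pathstart g = a" "pathfinish g = b"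
      proof (rule path_avoiding_sigma_compact[OF nc compact_imp_sigma_compact[OF comp]])
        show "a \<notin> frontier ?F" using a by (simp add: frontier_def)
        show "b \<notin> frontier ?F" using b cl frontier_subset_closed by blast
      qed
      have "a \<in> path_image g" "b \<in> path_image g" using g pathstart_in_path_image pathfinish_in_path_image by blast+
      moreover have "a \<in> ?F" using a interior_subset by blast
      ultimately have "path_image g \<inter> frontier ?F \<noteq> {}"
        using b by (intro connected_Int_frontier connected_path_image g(1)) blast+
      then show False using g by blast
    qed
    moreover have "closed ?F" using cont by (simp add: closed_vimage)
    \<comment> \<open>A closed set without interior is its own boundary.\<close>
    ultimately show ?thesis using comp by (simp add: frontier_def)
  qed
  then show ?thesis using cl by (simp add: proper_map_def vimage_def)
qed

lemma proper_map_compact_vimage: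
  "proper_map euclidean euclidean f \<Longrightarrow> compact K \<Longrightarrow> compact (f -` K)"
  using compactin_proper_map_preimage[of euclidean euclidean f K] by (simp add: vimage_def)

lemma proper_map_sigma_compact_vimage:
  assumes "proper_map euclidean euclidean f" "sigma_compact D"
  shows "sigma_compact (f -` D)"
proof -
  obtain \<K> where "countable \<K>" "\<forall>K\<in>\<K>. compact K" "D = \<Union>\<K>"
    using assms(2) by (auto simp: sigma_compact_def)
  then show ?thesis
    unfolding sigma_compact_def
    by (intro exI[of _ "(-`) f ` \<K>"]) (auto intro: proper_map_compact_vimage[OF assms(1)])
qed

subsection \<open>Local homeomorphisms and coverings\<close>

lemma has_derivative_fderiv:
  assumes "f differentiable (at x)"
  shows "(f has_derivative blinfun_apply (fderiv f x)) (at x)"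
proof -
  have d: "(f has_derivative frechet_derivative f (at x)) (at x)"
    using assms frechet_derivative_works by blast
  then have "blinfun_apply (fderiv f x) = frechet_derivative f (at x)"
    unfolding fderiv_def by (intro bounded_linear_Blinfun_apply has_derivative_bounded_linear)
  then show ?thesis using d by simp
qed

text \<open>Openness is asked of the images of all open subsets of \<open>W\<close>: this makes the
  local inverse continuous and allows \<open>W\<close> to be shrunk. One \<open>W\<close> serves all
  of its points, so the set of such points is open.\<close>

definition local_homeo_at :: "('a::topological_space \<Rightarrow> 'b::topological_space) \<Rightarrow> 'a \<Rightarrow> bool"
  where "local_homeo_at f x \<longleftrightarrow>
    (\<exists>W. open W \<and> x \<in> W \<and> inj_on f W \<and> (\<forall>V. open V \<longrightarrow> V \<subseteq> W \<longrightarrow> open (f ` V)))"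

lemma open_local_homeo_points: "open {x. local_homeo_at f x}"
  by (rule Topological_Spaces.openI) (auto simp: local_homeo_at_def)

text \<open>With \<open>C\<close> as an approximate inverse, \<open>f x = y\<close> becomes the
  fixed point equation \<open>x = C y - (C (f x) - x)\<close>, whose right-hand side contracts by
  1/2. Injectivity of \<open>C\<close> leads back to \<open>f x = y\<close>.\<close>

lemma lipschitz_perturbation_local_homeo:
  fixes f :: "'a::banach \<Rightarrow> 'b::real_normed_vector" and C :: "'b \<Rightarrow>\<^sub>L 'a"
  assumes W: "open W" "x0 \<in> W" and inj: "inj (blinfun_apply C)"
    and lip: "\<And>x y. x \<in> W \<Longrightarrow> y \<in> W \<Longrightarrow>
      norm ((blinfun_apply C (f x) - x) - (blinfun_apply C (f y) - y)) \<le> norm (x - y) / 2"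
  shows "local_homeo_at f x0"
  unfolding local_homeo_at_def
proof (intro exI[of _ W] conjI W allI impI)
  show "inj_on f W"
  proof (rule inj_onI)
    fix x y assume "x \<in> W" "y \<in> W" "f x = f y"
    then have "norm (y - x) \<le> norm (x - y) / 2" using lip[of x y] by simp
    then show "x = y" by (simp add: norm_minus_commute)
  qed
  fix V assume V: "open V" "V \<subseteq> W"
  show "open (f ` V)"
    unfolding open_contains_ball
  proof
    fix y0 assume "y0 \<in> f ` V"
    then obtain x1 where x1: "x1 \<in> V" "y0 = f x1" by blast
    obtain s where s: "s > 0" "cball x1 s \<subseteq> V" using V(1) x1(1) open_contains_cball by blast
    define h where "h x = blinfun_apply C (f x) - x" for x
    have pos: "norm C + 1 > 0" using norm_ge_zero[of C] by linarith
    \<comment> \<open>The shift of \<open>y\<close> contributes at most \<open>s / 2\<close> and the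
      contraction another \<open>s / 2\<close>, so the ball of radius \<open>s\<close> is mapped
      into itself.\<close>
    define d where "d = s / (2 * (norm C + 1))"
    have d: "d > 0" using s pos by (simp add: d_def)
    have "ball y0 d \<subseteq> f ` V"
    proof
      fix y assume y: "y \<in> ball y0 d"
      have "norm (blinfun_apply C (y - y0)) \<le> norm C * norm (y - y0)" by (rule norm_blinfun)
      also have "\<dots> \<le> (norm C + 1) * d"
        using y by (intro mult_mono) (auto simp: dist_norm norm_minus_commute)
      also have "\<dots> = s / 2" using pos by (simp add: d_def divide_simps)
      finally have Cy: "norm (blinfun_apply C (y - y0)) \<le> s / 2" .
      have hlip: "norm (h x - h z) \<le> norm (x - z) / 2" if "x \<in> cball x1 s" "z \<in> cball x1 s" for x z
        unfolding h_def using that s(2) V(2) by (intro lip) auto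
      have "\<exists>!x\<in>cball x1 s. blinfun_apply C y - h x = x"
      proof (rule Banach_fix[of _ "1/2"])
        show "complete (cball x1 s)" by (simp add: complete_eq_closed)
        show "(\<lambda>x. blinfun_apply C y - h x) ` cball x1 s \<subseteq> cball x1 s"
        proof (rule image_subsetI)
          fix x assume x: "x \<in> cball x1 s"
          have "(blinfun_apply C y - h x) - x1 = blinfun_apply C (y - y0) - (h x - h x1)"
            by (simp add: h_def x1 blinfun.diff_right)
          also have "norm \<dots> \<le> norm (blinfun_apply C (y - y0)) + norm (h x - h x1)"
            by (rule norm_triangle_ineq4)
          also have "\<dots> \<le> s / 2 + s / 2"
            using Cy hlip[OF x, of x1] x s by (intro add_mono) (auto simp: dist_norm norm_minus_commute)
          finally show "blinfun_apply C y - h x \<in> cball x1 s"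
            by (simp add: dist_norm norm_minus_commute)
        qed
        show "dist (blinfun_apply C y - h x) (blinfun_apply C y - h z) \<le> 1/2 * dist x z"
          if "x \<in> cball x1 s" "z \<in> cball x1 s" for x z
          using hlip[OF that] by (simp add: dist_norm norm_minus_commute)
      qed (use s in auto)
      then obtain x where x: "x \<in> cball x1 s" "blinfun_apply C y - h x = x" by blast
      then have "f x = y" using inj by (simp add: h_def inj_eq)
      then show "y \<in> f ` V" using x(1) s(2) by blast
    qed
    then show "\<exists>e>0. ball y0 e \<subseteq> f ` V" using d by blast
  qed
qed

text \<open>Let \<open>C\<close> be the inverse of the derivative at \<open>x0\<close>. The
  derivative of \<open>C (f x) - x\<close> at \<open>z\<close> is \<open>C\<close> composed with the
  change of \<open>fderiv f\<close> from \<open>x0\<close> to \<open>z\<close>; near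
  \<open>x0\<close> its norm is at most 1/2, and the mean value inequality on a ball gives the
  Lipschitz bound.\<close>

lemma inverse_function_theorem_local_homeo:
  fixes f :: "'a::banach \<Rightarrow> 'b::real_normed_vector"
  assumes C1: "C1_on f U" and x0: "x0 \<in> U" and inv: "invertible_operator (fderiv f x0)"
  shows "local_homeo_at f x0"
proof -
  let ?A = "fderiv f x0"
  obtain C :: "'b \<Rightarrow>\<^sub>L 'a" where C: "C o\<^sub>L ?A = id_blinfun" "?A o\<^sub>L C = id_blinfun"
    using inv unfolding invertible_operator_def by blast
  have CA: "blinfun_apply C (blinfun_apply ?A x) = x" for x
    using arg_cong[OF C(1), of "\<lambda>B. blinfun_apply B x"] by simp
  have AC: "blinfun_apply ?A (blinfun_apply C y) = y" for y
    using arg_cong[OF C(2), of "\<lambda>B. blinfun_apply B y"] by simp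
  have pos: "norm C + 1 > 0" using norm_ge_zero[of C] by linarith
  define d where "d = 1 / (2 * (norm C + 1))"
  have d: "d > 0" using pos by (simp add: d_def)
  have "open U" using C1 by (simp add: C1_on_def)
  then have "\<forall>\<^sub>F x in nhds x0. x \<in> U"
    using x0 by (rule eventually_nhds_in_open)
  moreover have "\<forall>\<^sub>F x in nhds x0. dist (fderiv f x) ?A < d"
  proof -
    have "isCont (fderiv f) x0"
      using C1 x0 \<open>open U\<close> unfolding C1_on_def by (metis continuous_on_eq_continuous_at)
    then have "(fderiv f \<longlongrightarrow> ?A) (nhds x0)" by (simp add: isCont_def tendsto_nhds_iff)
    then show ?thesis using d by (rule tendstoD)
  qed
  ultimately have "\<forall>\<^sub>F x in nhds x0. x \<in> U \<and> dist (fderiv f x) ?A < d" by eventually_elim simp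
  then obtain r where r: "r > 0" "\<And>x. dist x x0 < r \<Longrightarrow> x \<in> U \<and> dist (fderiv f x) ?A < d"
    unfolding eventually_nhds_metric by blast
  show ?thesis
  proof (rule lipschitz_perturbation_local_homeo)
    show "inj (blinfun_apply C)" by (metis AC injI)
    show "norm ((blinfun_apply C (f x) - x) - (blinfun_apply C (f y) - y)) \<le> norm (x - y) / 2"
      if xy: "x \<in> ball x0 r" "y \<in> ball x0 r" for x y
    proof -
      have "norm ((blinfun_apply C (f x) - x) - (blinfun_apply C (f y) - y)) \<le> 1/2 * norm (x - y)"
      proof (rule differentiable_bound[OF convex_ball _ _ xy,
            where f = "\<lambda>x. blinfun_apply C (f x) - x"
              and f' = "\<lambda>z w. blinfun_apply C (blinfun_apply (fderiv f z) w) - w"])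
        fix z assume "z \<in> ball x0 r"
        then have z: "z \<in> U" "dist (fderiv f z) ?A < d" using r(2)[of z] by (auto simp: dist_commute)
        have der: "(f has_derivative blinfun_apply (fderiv f z)) (at z)"
          using C1 z(1) unfolding C1_on_def by (blast intro: has_derivative_fderiv)
        show "((\<lambda>x. blinfun_apply C (f x) - x) has_derivative
            (\<lambda>w. blinfun_apply C (blinfun_apply (fderiv f z) w) - w)) (at z within ball x0 r)"
          by (rule has_derivative_at_withinI, rule has_derivative_diff[OF
              bounded_linear.has_derivative[OF blinfun.bounded_linear_right der] has_derivative_ident])
        show "onorm (\<lambda>w. blinfun_apply C (blinfun_apply (fderiv f z) w) - w) \<le> 1/2"
        proof (rule onorm_bound)
          fix w
          have "blinfun_apply C (blinfun_apply (fderiv f z) w) - w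
              = blinfun_apply C (blinfun_apply (fderiv f z - ?A) w)"
            by (simp add: blinfun.diff_left blinfun.diff_right CA)
          also have "norm \<dots> \<le> norm C * (norm (fderiv f z - ?A) * norm w)"
            by (intro order_trans[OF norm_blinfun] mult_left_mono norm_blinfun) auto
          also have "\<dots> \<le> (norm C + 1) * (d * norm w)"
            using z(2) d by (intro mult_mono) (auto simp: dist_norm)
          also have "\<dots> = 1/2 * norm w" using pos by (simp add: d_def field_simps)
          finally show "norm (blinfun_apply C (blinfun_apply (fderiv f z) w) - w) \<le> 1/2 * norm w" .
        qed simp
      qed
      then show ?thesis by simp
    qed
  qed (use r in auto)
qed

section \<open>Finite fibres and evenly covered neighbourhoods\<close>

text \<open>By injectivity each \<open>W x\<close> meets the fibre only in \<open>x\<close>, so a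
  finite subcover already lists the fibre.\<close>

lemma finite_discrete_fibre:
  fixes f :: "'a::topological_space \<Rightarrow> 'b"
  assumes comp: "compact (f -` {y})"
    and W: "\<And>x. x \<in> f -` {y} \<Longrightarrow> open (W x) \<and> x \<in> W x \<and> inj_on f (W x)"
  shows "finite (f -` {y})"
proof -
  obtain C where C: "C \<subseteq> f -` {y}" "finite C" "f -` {y} \<subseteq> (\<Union>c\<in>C. W c)"
    using compactE_image[OF comp, of "f -` {y}" W] W by blast
  have "f -` {y} \<subseteq> C"
  proof
    fix x assume x: "x \<in> f -` {y}"
    then obtain c where c: "c \<in> C" "x \<in> W c" using C(3) by blast
    then have "c \<in> W c" "inj_on f (W c)" "f x = f c" using C(1) W x by auto
    then have "x = c" using c(2) by (simp add: inj_on_eq_iff)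
    then show "x \<in> C" using c by simp
  qed
  then show ?thesis using C(2) finite_subset by blast
qed

lemma finite_imp_dist_separated:
  fixes F :: "'a::metric_space set"
  assumes "finite F"
  obtains d where "d > 0" "\<And>x y. x \<in> F \<Longrightarrow> y \<in> F \<Longrightarrow> dist x y < d \<Longrightarrow> x = y"
proof -
  \<comment> \<open>The element 1 keeps the minimum defined when there are no two distinct
    points.\<close>
  define A where "A = insert 1 ((\<lambda>(x, y). dist x y) ` {(x, y) \<in> F \<times> F. x \<noteq> y})"
  have A: "finite A" "A \<noteq> {}"
    unfolding A_def using finite_subset[of "{(x, y) \<in> F \<times> F. x \<noteq> y}" "F \<times> F"] assms by auto
  show ?thesis
  proof
    show "Min A > 0" using A by (auto simp: A_def)
    show "x = y" if "x \<in> F" "y \<in> F" "dist x y < Min A" for x y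
    proof (rule ccontr)
      assume "x \<noteq> y"
      then have "dist x y \<in> A" unfolding A_def using that by force
      then show False using that(3) A by (meson Min_le not_less)
    qed
  qed
qed

lemma proper_local_homeo_imp_covering_space:
  fixes f :: "'a::metric_space \<Rightarrow> 'b::metric_space"
  assumes cont: "continuous_on UNIV f" and proper: "proper_map euclidean euclidean f"
    and D: "closed D" "- D \<subseteq> range f"
    and loc: "\<And>x. f x \<notin> D \<Longrightarrow> local_homeo_at f x"
  shows "covering_space (- (f -` D)) f (- D)"
proof
  show "continuous_on (- (f -` D)) f" using cont continuous_on_subset by blast
  show "f ` (- (f -` D)) = - D" using D(2) by auto
  fix y assume y: "y \<in> - D"
  let ?F = "f -` {y}"
  have "\<exists>W. open W \<and> x \<in> W \<and> inj_on f W \<and> (\<forall>V. open V \<longrightarrow> V \<subseteq> W \<longrightarrow> open (f ` V))"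
    if "x \<in> ?F" for x
    using loc[of x] that y by (auto simp: local_homeo_at_def)
  then obtain W where W: "\<And>x. x \<in> ?F \<Longrightarrow> open (W x) \<and> x \<in> W x \<and> inj_on f (W x)"
    "\<And>x V. x \<in> ?F \<Longrightarrow> open V \<Longrightarrow> V \<subseteq> W x \<Longrightarrow> open (f ` V)"
    by metis
  have "compact ?F" using proper by (simp add: proper_map_compact_vimage)
  then have fin: "finite ?F" using W(1) by (rule finite_discrete_fibre)
  then obtain d where d: "d > 0" "\<And>x x'. x \<in> ?F \<Longrightarrow> x' \<in> ?F \<Longrightarrow> dist x x' < d \<Longrightarrow> x = x'"
    using finite_imp_dist_separated[OF fin] by blast
  have clE: "closed (f -` D)" using cont D(1) by (simp add: closed_vimage)
  define U where "U x = W x \<inter> ball x (d/2) \<inter> - (f -` D)" for x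
  have U: "open (U x)" "x \<in> U x" "U x \<subseteq> W x" "U x \<subseteq> - (f -` D)" if "x \<in> ?F" for x
    using W(1)[OF that] clE d(1) that y by (auto simp: U_def intro!: open_Int)
  have disj: "U x \<inter> U x' = {}" if "x \<in> ?F" "x' \<in> ?F" "x \<noteq> x'" for x x'
  proof (rule ccontr)
    assume "U x \<inter> U x' \<noteq> {}"
    then obtain z where "dist x z < d/2" "dist x' z < d/2" by (auto simp: U_def)
    then have "dist x x' < d" using dist_triangle_half_l[of x z d x'] by (simp add: dist_commute)
    then show False using d(2) that by blast
  qed
  \<comment> \<open>The second part discards the values taken outside the sheets, so that the
    preimage of \<open>V\<close> lies in their union; it is open because \<open>f\<close> is a
    closed map.\<close>
  define V where "V = (\<Inter>x\<in>?F. f ` U x) \<inter> - (f ` (- (\<Union>x\<in>?F. U x)))"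
  have "open V"
  proof -
    have "open (\<Inter>x\<in>?F. f ` U x)"
      using fin U(1,3) W(2) by (intro open_INT) auto
    moreover have "closed (- (\<Union>x\<in>?F. U x))" using U(1) by (auto intro!: open_UN)
    then have "closed (f ` (- (\<Union>x\<in>?F. U x)))"
      using proper by (simp add: proper_map_def closed_map_def)
    ultimately show ?thesis unfolding V_def by (intro open_Int) auto
  qed
  have yV: "y \<in> V"
    using U(2) by (auto simp: V_def)
  \<comment> \<open>Over an empty fibre the intersection of the images would be the whole space; a
    point of the fibre confines \<open>V\<close> to \<open>- D\<close>.\<close>
  obtain x0 where x0: "x0 \<in> ?F" using D(2) y by auto
  have "V \<subseteq> f ` U x0" using x0 by (auto simp: V_def)
  also have "\<dots> \<subseteq> - D" using U(4)[OF x0] by auto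
  finally have VD: "V \<subseteq> - D" .
  let ?v = "(\<lambda>x. U x \<inter> f -` V) ` ?F"
  show "\<exists>T. y \<in> T \<and> openin (top_of_set (- D)) T \<and>
      (\<exists>v. \<Union>v = - (f -` D) \<inter> f -` T \<and> (\<forall>u\<in>v. openin (top_of_set (- (f -` D))) u) \<and>
        pairwise disjnt v \<and> (\<forall>u\<in>v. \<exists>q. homeomorphism u T f q))"
  proof (intro exI[of _ V] conjI exI[of _ ?v] yV)
    show "openin (top_of_set (- D)) V"
      using \<open>open V\<close> VD by (simp add: open_subset)
    show "\<Union>?v = - (f -` D) \<inter> f -` V"
      using U(4) by (auto simp: V_def)
    have oU: "open (U x \<inter> f -` V)" if "x \<in> ?F" for x
      using U(1)[OF that] cont \<open>open V\<close> by (intro open_Int open_vimage)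
    show "\<forall>u\<in>?v. openin (top_of_set (- (f -` D))) u"
      using oU U(4) by (auto intro!: open_subset)
    show "pairwise disjnt ?v"
      using disj unfolding pairwise_def disjnt_def by blast
    show "\<forall>u\<in>?v. \<exists>q. homeomorphism u V f q"
    proof
      fix u assume "u \<in> ?v"
      then obtain x where x: "x \<in> ?F" "u = U x \<inter> f -` V" by blast
      have uW: "u \<subseteq> W x" using U(3)[OF x(1)] x(2) by blast
      obtain q where "homeomorphism u V f q"
      proof (rule homeomorphism_injective_open_map)
        show "continuous_on u f" using cont continuous_on_subset by blast
        have "V \<subseteq> f ` U x" using x(1) by (auto simp: V_def)
        then show "f ` u = V" using x(2) by blast
        show "inj_on f u" using W(1)[OF x(1)] uW inj_on_subset by blast
        fix S assume "openin (top_of_set u) S"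
        then have "open S" "S \<subseteq> u"
          using oU[OF x(1)] x(2) openin_open_eq by blast+
        then have "open (f ` S)" using W(2)[OF x(1)] uW by blast
        moreover have "f ` S \<subseteq> V" using \<open>S \<subseteq> u\<close> x(2) by blast
        ultimately show "openin (top_of_set V) (f ` S)" by (simp add: open_subset)
      qed
      then show "\<exists>q. homeomorphism u V f q" by blast
    qed
  qed
qed

text \<open>A path between two points of a fibre maps to a loop that a cone contracts in the base.\<close>
lemma covering_space_sigma_compact_complement_inj:
  fixes f :: "'a::banach \<Rightarrow> 'b::banach"
  assumes nc: "\<And>K :: 'a set. compact K \<Longrightarrow> interior K = {}"
    and nc': "\<And>K :: 'b set. compact K \<Longrightarrow> interior K = {}"
    and sc: "sigma_compact E" "sigma_compact D"
    and cov: "covering_space (- E) f (- D)"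
  shows "inj_on f (- E)"
proof (rule inj_onI)
  fix x1 x2 assume x: "x1 \<in> - E" "x2 \<in> - E" "f x1 = f x2"
  obtain g where g: "path g" "path_image g \<inter> E = {}" "pathstart g = x1" "pathfinish g = x2"
    using path_avoiding_sigma_compact[OF nc sc(1), of x1 x2] x by auto
  have gE: "path_image g \<subseteq> - E" using g(2) by blast
  have fE: "f ` (- E) = - D" and cf: "continuous_on (- E) f"
    using cov by (auto simp: covering_space_def)
  define p where "p = f \<circ> g"
  have p: "path p" "path_image p \<subseteq> - D"
    unfolding p_def using gE fE cf g(1)
    by (auto simp: path_image_compose intro!: path_continuous_image intro: continuous_on_subset)
  obtain c where c: "\<And>a. a \<in> path_image p \<Longrightarrow> closed_segment a c \<inter> D = {}"
    using cone_avoiding_sigma_compact[OF nc' sc(2) compact_path_image[OF p(1)]] p(2) by blast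
  \<comment> \<open>The cone with apex \<open>c\<close> over the loop is the trace of the
    straight-line homotopy to the constant loop.\<close>
  have "homotopic_loops (- D) p (linepath c c)"
  proof (rule homotopic_loops_linear)
    show "closed_segment (p t) (linepath c c t) \<subseteq> - D" if "t \<in> {0..1}" for t
      using c[of "p t"] that by (auto simp: path_image_def linepath_refl)
    show "pathfinish p = pathstart p"
      using g x(3) by (simp add: pathfinish_compose pathstart_compose p_def)
  qed (use p in auto)
  \<comment> \<open>A loop freely homotopic to a constant one is also contractible with its
    endpoints fixed.\<close>
  then have hom: "homotopic_paths (- D) p (linepath (f x1) (f x1))"
    using homotopic_loops_imp_homotopic_paths_null g(3) by (fastforce simp: p_def pathstart_compose)
  \<comment> \<open>Both \<open>g\<close> and the constant path at \<open>x1\<close> are lifts that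
    start at \<open>x1\<close>; monodromy gives them the same end.\<close>
  have "pathfinish g = pathfinish (linepath x1 x1)"
  proof (rule covering_space_monodromy[OF cov p _ _ hom g(1) gE])
    show "path_image (linepath (f x1) (f x1)) \<subseteq> - D" using x(1) fE by auto
    show "path_image (linepath x1 x1) \<subseteq> - E" using x(1) by simp
    show "f (linepath x1 x1 t) = linepath (f x1) (f x1) t" for t by (simp add: linepath_refl)
  qed (use g in \<open>simp_all add: p_def\<close>)
  then show "x1 = x2" using g(4) by simp
qed

subsection \<open>Singular values of potential operators\<close>

lemma gateaux_derivative_at_min:
  fixes f :: "'a::real_normed_vector \<Rightarrow> real"
  assumes der: "has_gateaux_derivative f A x"
    and min: "\<And>z. f x - blinfun_apply \<phi> x \<le> f z - blinfun_apply \<phi> z"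
  shows "A = \<phi>"
proof -
  have le: "blinfun_apply \<phi> h \<le> blinfun_apply A h" for h
  proof (rule tendsto_lowerbound)
    show "((\<lambda>t::real. (f (x + t *\<^sub>R h) - f x) /\<^sub>R t) \<longlongrightarrow> blinfun_apply A h) (at_right 0)"
      using der unfolding has_gateaux_derivative_def
      by (meson filterlim_at_split)
    have "blinfun_apply \<phi> h \<le> (f (x + t *\<^sub>R h) - f x) /\<^sub>R t" if "t > 0" for t
      using min[of "x + t *\<^sub>R h"] that
      by (simp add: blinfun.add_right blinfun.scaleR_right field_simps)
    then show "\<forall>\<^sub>F t in at_right 0. blinfun_apply \<phi> h \<le> (f (x + t *\<^sub>R h) - f x) /\<^sub>R t"
      by (auto simp: eventually_at_right_field intro: gt_ex)
  qed simp
  have "blinfun_apply A h = blinfun_apply \<phi> h" for h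
    using le[of h] le[of "- h"] by (simp add: blinfun.minus_right)
  then show ?thesis by (rule blinfun_eqI)
qed

text \<open>Adding the support inequalities of \<open>x\<close> at \<open>y\<close> and of
  \<open>y\<close> at \<open>x\<close> cancels \<open>J\<close>.\<close>

lemma monotone_operatorI_support:
  assumes "\<And>x z. J x + blinfun_apply (T x) (z - x) \<le> J z"
  shows "monotone_operator T"
  unfolding monotone_operator_def
proof (intro allI)
  fix x y
  show "0 \<le> blinfun_apply (T x - T y) (x - y)"
    using assms[of x y] assms[of y x] by (simp add: blinfun.diff_left blinfun.diff_right)
qed

lemma monotone_if_sigma_compact_singular_values:
  fixes T :: "'a::banach \<Rightarrow> ('a \<Rightarrow>\<^sub>L real)"
  assumes inf: "infinite_dimensional TYPE('a)" and refl: "reflexive_space TYPE('a)"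
    and cont: "continuous_on UNIV T" and pot: "potential_operator T"
    and cl: "closed_map euclidean euclidean T"
    and lsc: "seq_weakly_lsc (potential T)"
    and coer: "\<And>\<phi> :: 'a \<Rightarrow>\<^sub>L real. coercive (\<lambda>x. potential T x + blinfun_apply \<phi> x)"
    and B: "sigma_compact B" and C1: "C1_on T (UNIV - B)"
    and sc: "sigma_compact (T ` singular_points T (UNIV - B))"
  shows "monotone_operator T"
proof (cases "\<exists>c. \<forall>x. T x = c")
  \<comment> \<open>A constant map is closed without being proper here, so it is treated
    apart.\<close>
  case True
  then show ?thesis by (auto simp: monotone_operator_def)
next
  case nonconst: False
  note nc = compact_interior_empty[OF inf]
  let ?J = "potential T"
  have proper: "proper_map euclidean euclidean T"
    by (rule closed_map_imp_proper_map[OF nc cont cl nonconst])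
  \<comment> \<open>This yields at once the surjectivity of \<open>T\<close> and, for each value, a
    preimage at which \<open>\<phi>\<close> supports the potential.\<close>
  have minimiser: "\<exists>x. T x = \<phi> \<and> (\<forall>z. ?J x + blinfun_apply \<phi> (z - x) \<le> ?J z)" for \<phi>
  proof -
    obtain x where x: "\<And>z. ?J x + blinfun_apply (- \<phi>) x \<le> ?J z + blinfun_apply (- \<phi>) z"
      using coercive_weakly_lsc_attains_min[OF refl seq_weakly_lsc_add_blinfun[OF lsc] coer[of "- \<phi>"]]
      by blast
    have "T x = \<phi>"
      using pot x by (intro gateaux_derivative_at_min[of ?J])
        (auto simp: potential_operator_def blinfun.minus_left)
    moreover have "?J x + blinfun_apply \<phi> (z - x) \<le> ?J z" for z
      using x[of z] by (simp add: blinfun.minus_left blinfun.diff_right)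
    ultimately show ?thesis by blast
  qed
  \<comment> \<open>Smallness of compact sets passes to the dual through \<open>T\<close>: a compact
    set has compact preimage, and a nonempty interior would have a nonempty open preimage.\<close>
  have nc': "interior K = {}" if "compact K" for K :: "('a \<Rightarrow>\<^sub>L real) set"
  proof (rule ccontr)
    assume "interior K \<noteq> {}"
    obtain \<phi> where \<phi>: "\<phi> \<in> interior K" using \<open>interior K \<noteq> {}\<close> by blast
    have "open (T -` interior K)" using cont by (intro open_vimage) auto
    moreover have "T -` interior K \<subseteq> T -` K" using interior_subset by (rule vimage_mono)
    ultimately have "T -` interior K \<subseteq> interior (T -` K)" by (rule interior_maximal[rotated])
    moreover have "interior (T -` K) = {}"
      by (rule nc) (rule proper_map_compact_vimage[OF proper that])
    ultimately show False using minimiser \<phi> by blast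
  qed
  define D where "D = T ` {x. \<not> local_homeo_at T x}"
  have "closed D"
    using cl open_local_homeo_points[of T]
    unfolding D_def closed_map_def by (simp add: closed_def Collect_neg_eq)
  have "{x. \<not> local_homeo_at T x} \<subseteq> singular_points T (UNIV - B) \<union> B"
    using inverse_function_theorem_local_homeo[OF C1] by (auto simp: singular_points_def)
  then have "D \<subseteq> T ` singular_points T (UNIV - B) \<union> T ` B" unfolding D_def by blast
  moreover have "sigma_compact (T ` B)"
    using B cont continuous_on_subset by (blast intro: sigma_compact_image)
  \<comment> \<open>\<open>D\<close> is only contained in a sigma-compact set, but it is a closed
    part of it.\<close>
  ultimately have D: "sigma_compact D"
    using sigma_compact_closed_Int[OF sigma_compact_Un[OF sc] \<open>closed D\<close>]
    by (metis inf.absorb1)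
  define E where "E = T -` D"
  have E: "sigma_compact E" unfolding E_def by (rule proper_map_sigma_compact_vimage[OF proper D])
  have "surj T" using minimiser by (metis surjI)
  then have "covering_space (- E) T (- D)"
    unfolding E_def
    by (intro proper_local_homeo_imp_covering_space cont proper \<open>closed D\<close>) (auto simp: D_def)
  then have inj: "inj_on T (- E)"
    using covering_space_sigma_compact_complement_inj[OF nc nc' E D] by blast
  have contJ: "continuous_on UNIV ?J"
    using pot unfolding potential_operator_def C1_on_def
    by (intro differentiable_imp_continuous_on) (auto simp: differentiable_on_def)
  have support: "?J x + blinfun_apply (T x) (z - x) \<le> ?J z" for x z
  proof -
    have "closed {x. ?J x + blinfun_apply (T x) (z - x) \<le> ?J z}"
      by (intro closed_Collect_le continuous_intros contJ cont)
    moreover have "- E \<subseteq> {x. ?J x + blinfun_apply (T x) (z - x) \<le> ?J z}"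
    proof
      fix x assume x: "x \<in> - E"
      obtain x' where x': "T x' = T x" "\<And>z. ?J x' + blinfun_apply (T x) (z - x') \<le> ?J z"
        using minimiser by blast
      \<comment> \<open>\<open>E\<close> is a full preimage, so \<open>x'\<close> lies outside
        \<open>E\<close> as well and injectivity applies.\<close>
      then have "x' = x" using inj x by (auto simp: inj_on_def E_def)
      then show "x \<in> {x. ?J x + blinfun_apply (T x) (z - x) \<le> ?J z}" using x'(2) by simp
    qed
    ultimately have "closure (- E) \<subseteq> {x. ?J x + blinfun_apply (T x) (z - x) \<le> ?J z}"
      by (simp add: closure_minimal)
    \<comment> \<open>By Baire, \<open>E\<close> has no interior, so the closed support condition
      spreads to all points.\<close>
    moreover have "closure (- E) = UNIV"
      using sigma_compact_interior_empty[OF nc E] by (simp add: closure_complement)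
    ultimately show ?thesis by blast
  qed
  then show ?thesis by (rule monotone_operatorI_support)
qed

theorem theorem2:
  fixes T :: "'a::banach \<Rightarrow> ('a \<Rightarrow>\<^sub>L real)"
    and B :: "'a set"
  assumes "infinite_dimensional TYPE('a)"
    and "reflexive_space TYPE('a)"
    and "continuous_on UNIV T"
    and "potential_operator T"
    and "closed_map euclidean euclidean T"
    and "\<not> monotone_operator T"
    and "seq_weakly_lsc (potential T)"
    and "\<And>\<phi> :: 'a \<Rightarrow>\<^sub>L real. coercive (\<lambda>x. potential T x + blinfun_apply \<phi> x)"
    and "closed B"
    and "sigma_compact B"
    and "C1_on T (UNIV - B)"
  shows "\<not> sigma_compact (singular_points T (UNIV - B)) \<and>
         \<not> sigma_compact (T ` singular_points T (UNIV - B))"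
proof -
  have image: "\<not> sigma_compact (T ` singular_points T (UNIV - B))"
    using monotone_if_sigma_compact_singular_values[OF assms(1-5) assms(7,8,10,11)] assms(6) by blast
  \<comment> \<open>Continuous images preserve sigma-compactness, so the claim about the values is
    the stronger one.\<close>
  moreover have "\<not> sigma_compact (singular_points T (UNIV - B))"
    using image sigma_compact_image continuous_on_subset[OF assms(3)] by blast
  ultimately show ?thesis by blast
qed

end
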